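(* Let $X_1, X_2 \subset \mathbb{Z}^2$ be digitally convex disks. Let $(X,c_2) = (X_1 \vee X_2, c_2)$ be their wedge. Then (1) there is a $c_2$-retraction $r: \mathbb{Z}^2 \to X$; and (2) $(X,c_2)$ has the approximate fixed point property (AFPP).
   Context: Adjacency: two distinct points of $\mathbb{Z}^2$ are $c_2$-adjacent if each of their coordinates differs by at most $1$ (8-adjacency), and $c_1$-adjacent if they differ by exactly $1$ in exactly one coordinate and agree in the other (4-adjacency). A set $Y$ is $\kappa$-connected if any two of its points are joined by a finite sequence of points of $Y$ in which consecutive points are $\kappa$-adjacent; a $\kappa$-component of a set is a maximal $\kappa$-connected subset. A function $f$ between subsets of $\mathbb{Z}^2$ is $c_2$-continuous if, whenever $x,x'$ are $c_2$-adjacent, $f(x)$ and $f(x')$ are $c_2$-adjacent or equal. For $X \subset Y \subset \mathbb{Z}^2$, a $c_2$-retraction $r: Y \to X$ is a $c_2$-continuous function with $r(x)=x$ for all $x\in X$. $(X,c_2)$ has the AFPP if for every $c_2$-continuous $f: X\to X$ there is $x\in X$ such that $f(x)$ is $c_2$-adjacent or equal to $x$. Wedge: $(X,c_2)=(X_1\vee X_2,c_2)$ means that $X=X_1\cup X_2$, that $X_1\cap X_2=\{x_0\}$ is a single point (the wedge point), and that whenever $x,x'\in X$ are $c_2$-adjacent, either $\{x,x'\}\subset X_1$ or $\{x,x'\}\subset X_2$. A digital line segment is a finite $c_2$-connected set of more than one collinear points of $\mathbb{Z}^2$ (hence horizontal, vertical, or of slope $\pm 1$). A $c_2$-closed curve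 is a sequence $S=\{s_i\}_{i=0}^{m-1}$ of distinct points of $\mathbb{Z}^2$ with $s_i$ $c_2$-adjacent to $s_{(i+1) \bmod m}$ for $0\le i\le m-1$. If $S$ is a $c_2$-closed curve such that $\mathbb{Z}^2\setminus S$ has two $c_1$-components, one finite (possibly empty) and the other infinite, then the union $D$ of $S$ and the finite component is a (digital) disk and $S$ is a bounding curve of $D$. An edge of $S$ is a maximal digital line segment in $S$. A digitally convex disk is a digital disk $Y$ that has a bounding curve $S$ such that the endpoints of the edges of $S$ are the vertices of the Euclidean convex hull of $Y$ in $\mathbb{R}^2$.
   Formalization: Edges of S are runs of consecutive points of S, and in a digitally convex disk each edge must also lie on the boundary of the convex hull of Y; this excludes bounding curves that cross themselves, for which (1) can fail. *)

theory Defs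
  imports "HOL-Analysis.Analysis"
begin

type_synonym pixel = "int \<times> int"

definition c1_adj :: "pixel \<Rightarrow> pixel \<Rightarrow> bool" where
  "c1_adj p q \<longleftrightarrow>
     (\<bar>fst p - fst q\<bar> = 1 \<and> snd p = snd q) \<or> (fst p = fst q \<and> \<bar>snd p - snd q\<bar> = 1)"

definition c2_adj :: "pixel \<Rightarrow> pixel \<Rightarrow> bool" where
  "c2_adj p q \<longleftrightarrow> p \<noteq> q \<and> \<bar>fst p - fst q\<bar> \<le> 1 \<and> \<bar>snd p - snd q\<bar> \<le> 1"

definition dig_connected :: "(pixel \<Rightarrow> pixel \<Rightarrow> bool) \<Rightarrow> pixel set \<Rightarrow> bool" where
  "dig_connected adj Y \<longleftrightarrow>
     (\<forall>p\<in>Y. \<forall>q\<in>Y. (\<lambda>a b. a \<in> Y \<and> b \<in> Y \<and> adj a b)\<^sup>*\<^sup>* p q)"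

definition dig_component :: "(pixel \<Rightarrow> pixel \<Rightarrow> bool) \<Rightarrow> pixel set \<Rightarrow> pixel set \<Rightarrow> bool" where
  "dig_component adj A C \<longleftrightarrow>
     C \<subseteq> A \<and> dig_connected adj C \<and>
     (\<forall>C'. C \<subseteq> C' \<and> C' \<subseteq> A \<and> dig_connected adj C' \<longrightarrow> C' = C)"

definition c2_continuous :: "pixel set \<Rightarrow> pixel set \<Rightarrow> (pixel \<Rightarrow> pixel) \<Rightarrow> bool" where
  "c2_continuous A B f \<longleftrightarrow>
     f ` A \<subseteq> B \<and> (\<forall>x\<in>A. \<forall>x'\<in>A. c2_adj x x' \<longrightarrow> c2_adj (f x) (f x') \<or> f x = f x')"

definition c2_retraction :: "pixel set \<Rightarrow> pixel set \<Rightarrow> (pixel \<Rightarrow> pixel) \<Rightarrow> bool" where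
  "c2_retraction Y X r \<longleftrightarrow> X \<subseteq> Y \<and> c2_continuous Y X r \<and> (\<forall>x\<in>X. r x = x)"

definition c2_AFPP :: "pixel set \<Rightarrow> bool" where
  "c2_AFPP X \<longleftrightarrow>
     (\<forall>f. c2_continuous X X f \<longrightarrow> (\<exists>x\<in>X. c2_adj (f x) x \<or> f x = x))"

definition c2_wedge :: "pixel set \<Rightarrow> pixel set \<Rightarrow> pixel set \<Rightarrow> bool" where
  "c2_wedge X X1 X2 \<longleftrightarrow>
     X = X1 \<union> X2 \<and> (\<exists>x0. X1 \<inter> X2 = {x0}) \<and>
     (\<forall>x\<in>X. \<forall>x'\<in>X. c2_adj x x' \<longrightarrow> {x, x'} \<subseteq> X1 \<or> {x, x'} \<subseteq> X2)"

definition to_plane :: "pixel \<Rightarrow> real \<times> real" where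
  "to_plane p = (real_of_int (fst p), real_of_int (snd p))"

definition plane_hull :: "pixel set \<Rightarrow> (real \<times> real) set" where
  "plane_hull Y = convex hull (to_plane ` Y)"

definition digital_segment :: "pixel set \<Rightarrow> bool" where
  "digital_segment L \<longleftrightarrow>
     finite L \<and> dig_connected c2_adj L \<and> card L > 1 \<and> collinear (to_plane ` L)"

definition segment_endpoints :: "pixel set \<Rightarrow> pixel set" where
  "segment_endpoints L = {p \<in> L. to_plane p extreme_point_of plane_hull L}"

definition c2_closed_curve :: "pixel list \<Rightarrow> bool" where
  "c2_closed_curve s \<longleftrightarrow>
     s \<noteq> [] \<and> distinct s \<and>
     (\<forall>i<length s. c2_adj (s ! i) (s ! ((i + 1) mod length s)))"

text \<open>
  In \<open>bounding_curve\<close>, \<open>F\<close> is the finite component. It may be empty, and then the infinite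
  component \<open>I\<close> is the only component of the complement of the curve; removing the empty set
  from \<open>{F, I}\<close> covers both cases.
\<close>

definition bounding_curve :: "pixel list \<Rightarrow> pixel set \<Rightarrow> bool" where
  "bounding_curve s D \<longleftrightarrow>
     c2_closed_curve s \<and>
     (\<exists>F I. finite F \<and> infinite I \<and>
            {C. dig_component c1_adj (- set s) C} = {F, I} - {{}} \<and>
            D = set s \<union> F)"

definition digital_disk :: "pixel set \<Rightarrow> bool" where
  "digital_disk D \<longleftrightarrow> (\<exists>s. bounding_curve s D)"

text \<open>
  A segment in a closed curve is one that the curve traverses, that is, a cyclic run of
  consecutive members of the sequence. With arbitrary subsets of the trace instead, the side
  neighbours \<open>(0, 1)\<close> and \<open>(1, 0)\<close> of the corner \<open>(0, 0)\<close> of a square with side length at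
  least 2 would form an edge, and squares would not be digitally convex.
\<close>

definition curve_run :: "pixel list \<Rightarrow> pixel set \<Rightarrow> bool" where
  "curve_run s L \<longleftrightarrow>
     (\<exists>i<length s. \<exists>k<length s. L = (\<lambda>j. s ! ((i + j) mod length s)) ` {..k})"

definition curve_edge :: "pixel list \<Rightarrow> pixel set \<Rightarrow> bool" where
  "curve_edge s L \<longleftrightarrow>
     curve_run s L \<and> digital_segment L \<and>
     (\<forall>L'. curve_run s L' \<and> digital_segment L' \<and> L \<subseteq> L' \<longrightarrow> L' = L)"

text \<open>
  The edges of the curve are the sides of the hull polygon: their endpoints are its vertices, and
  they lie on its boundary. The latter excludes curves that cross themselves between lattice
  points, which can pass through all hull vertices in the wrong order. For example,
  \<open>(0,0), (1,1), (2,2), (2,1), (2,0), (2,-1), (1,0), (0,1)\<close> is a closed curve whose edge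
  endpoints are the four hull vertices, but its slanted edges are diagonals of the hull.
\<close>

definition digitally_convex_disk :: "pixel set \<Rightarrow> bool" where
  "digitally_convex_disk Y \<longleftrightarrow>
     digital_disk Y \<and>
     (\<exists>s. bounding_curve s Y \<and>
          to_plane ` (\<Union>L\<in>{L. curve_edge s L}. segment_endpoints L)
            = {v. v extreme_point_of plane_hull Y} \<and>
          (\<forall>L. curve_edge s L \<longrightarrow> plane_hull L \<subseteq> frontier (plane_hull Y)))"

end

theory Submission
  imports Defs
begin

text \<open>
  Say that a set of pixels is closed if it is the set of all pixels that satisfy a system of
  inequalities bounding \<open>x\<close>, \<open>y\<close>, \<open>x + y\<close> and \<open>x - y\<close> from both sides, that is, the set of
  lattice points of an octagon; \<open>oct_hull\<close> is the corresponding closure operator. The theorem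
  rests on four facts.

  A digitally convex disk is closed (\<open>digitally_convex_disk_oct_hull\<close>). Each step of the bounding
  curve \<open>S\<close> lies in an edge, hence on the frontier of the convex hull, so the disk \<open>Y\<close> lies on one
  side of the line through the step (\<open>curve_step_one_side\<close>). At a pixel of \<open>S\<close>, the two
  incident steps therefore span the cone of directions into \<open>Y\<close>, and a side of the octagonal hull
  that starts there must follow one of them (\<open>extend_along_side\<close>). So \<open>S\<close> contains every boundary
  pixel of the octagonal hull (\<open>whole_side\<close>), and no 4-path avoiding \<open>S\<close> leaves the hull: a pixel
  of the hull that is not on \<open>S\<close> is in the finite component
  (\<open>oct_hull_subset_of_sides\<close>). A bounding curve of two pixels encloses nothing.

  A finite nonempty closed set is a retract of the plane (\<open>oct_hull_closed_retract\<close>): clip to the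
  bounding box, then push the pixels beyond each of the four slanted sides diagonally onto it.

  The retractions onto the two sets of a wedge can be glued (\<open>wedge_retract\<close>). With the wedge point as
  origin, the plane consists of four open sectors around the axes and four diagonal rays. A
  closed set through the origin which meets one of these pieces contains the neighbour of the
  origin in that piece. Neighbours in different sets are not adjacent, so the
  pieces met by one set are, except at the origin, at distance at least 2 from those met by the
  other. Flattening the sectors that meet neither set onto their sides is a nonexpansive map, and
  on its image one may apply one retraction in the pieces of the first set and the other one in the
  pieces of the second set.

  A finite retract of the plane has the AFPP (\<open>finite_retract_AFPP\<close>): composing a continuous self-map
  with the retraction gives a nonexpansive map \<open>f\<close> of the plane with finite range. Let a pursuer
  at \<open>c\<close> move one step towards \<open>f c\<close> in each coordinate. The target \<open>f c\<close> also moves by at most one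
  step and stays in a bounded region, so the pursuer comes within distance 1 of it.
\<close>

section \<open>Supporting lines of the bounding curve\<close>

text \<open>
  The determinant (signed area) of two plane vectors. For fixed \<open>u\<close>, the sign of \<open>det2 u v\<close> tells
  on which side of the line spanned by \<open>u\<close> the vector \<open>v\<close> lies. It is polymorphic so that it
  applies both to pixels and to points of the real plane.
\<close>

definition det2 :: "'a::comm_ring \<times> 'a \<Rightarrow> 'a \<times> 'a \<Rightarrow> 'a" where
  "det2 u v = fst u * snd v - snd u * fst v"

lemma det2_add_right: "det2 u (v + w) = det2 u v + det2 u w"
  by (simp add: det2_def algebra_simps)

lemma det2_diff_right: "det2 u (v - w) = det2 u v - det2 u w"
  by (simp add: det2_def algebra_simps)

lemma det2_minus_left: "det2 (- u) v = - det2 u v"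
  by (simp add: det2_def algebra_simps)

lemma det2_swap: "det2 u v = - det2 v u"
  by (simp add: det2_def algebra_simps)

lemma det2_to_plane:
  "det2 (to_plane q - to_plane p) (to_plane y - to_plane p) = real_of_int (det2 (q - p) (y - p))"
  by (simp add: det2_def to_plane_def)

lemma supporting_hyperplane_frontier:
  fixes H :: "'a::euclidean_space set"
  assumes "convex H" "x \<in> frontier H" "x \<in> H"
  obtains a where "a \<noteq> 0" "\<And>y. y \<in> H \<Longrightarrow> a \<bullet> x \<le> a \<bullet> y"
proof (cases "interior H = {}")
  case True
  then obtain a b where ab: "a \<noteq> 0" "H \<subseteq> {x. a \<bullet> x = b}"
    using empty_interior_subset_hyperplane[OF assms(1)] by blast
  show thesis
  proof (rule that[OF ab(1)])
    fix y assume "y \<in> H"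
    with assms(3) ab(2) have "a \<bullet> x = b" "a \<bullet> y = b" by auto
    then show "a \<bullet> x \<le> a \<bullet> y" by simp
  qed
next
  case False
  then have "rel_interior H = interior H"
    by (rule rel_interior_nonempty_interior)
  with assms(2) have "x \<notin> rel_interior H"
    by (simp add: frontier_def)
  moreover have "x \<in> closure H"
    using assms(3) closure_subset by blast
  ultimately obtain a where a: "a \<noteq> 0" "\<And>y. y \<in> closure H \<Longrightarrow> a \<bullet> x \<le> a \<bullet> y"
    using supporting_hyperplane_relative_frontier[OF assms(1)] by blast
  show thesis
    by (rule that[OF a(1)]) (use a(2) closure_subset in blast)
qed

text \<open>
  A line that supports a convex set at the midpoint of a segment of the set contains the
  segment, so it is the line through the end points of the segment.
\<close>

lemma frontier_segment_one_side:
  fixes H :: "(real \<times> real) set"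
  assumes "convex H" "p \<in> H" "q \<in> H" "p \<noteq> q" "midpoint p q \<in> frontier H"
  shows "(\<forall>y\<in>H. 0 \<le> det2 (q - p) (y - p)) \<or> (\<forall>y\<in>H. det2 (q - p) (y - p) \<le> 0)"
proof -
  have mH: "midpoint p q \<in> H"
    using assms(1-3) by (meson convex_contains_segment midpoint_in_closed_segment subsetD)
  obtain a where a: "a \<noteq> 0" "\<And>y. y \<in> H \<Longrightarrow> a \<bullet> midpoint p q \<le> a \<bullet> y"
    using supporting_hyperplane_frontier[OF assms(1,5) mH] by blast
  have mid: "a \<bullet> midpoint p q = (a \<bullet> p + a \<bullet> q) / 2"
    by (simp add: midpoint_def inner_add_right)
  have apq: "a \<bullet> p = a \<bullet> q" "a \<bullet> midpoint p q = a \<bullet> p"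
    using a(2)[OF assms(2)] a(2)[OF assms(3)] mid by auto
  have orth: "a \<bullet> (q - p) = 0"
    using apq by (simp add: inner_diff_right)
  (* d = q - p and its rotation by a right angle form an orthogonal basis; a has no d-component. *)
  have key: "(a \<bullet> z) * ((q - p) \<bullet> (q - p)) = det2 (q - p) a * det2 (q - p) z" for z
  proof -
    have "(a \<bullet> z) * ((q - p) \<bullet> (q - p))
        = (a \<bullet> (q - p)) * (z \<bullet> (q - p)) + det2 (q - p) a * det2 (q - p) z"
      by (simp add: det2_def inner_prod_def algebra_simps)
    with orth show ?thesis by simp
  qed
  have pos: "0 < (q - p) \<bullet> (q - p)"
    using assms(4) by simp
  have "0 \<le> det2 (q - p) a * det2 (q - p) (y - p)" if "y \<in> H" for y
  proof -
    have "0 \<le> a \<bullet> (y - p)"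
      using a(2)[OF that] apq by (simp add: inner_diff_right)
    then show ?thesis
      using key[of "y - p"] pos by (metis less_imp_le mult_nonneg_nonneg)
  qed
  moreover have "det2 (q - p) a \<noteq> 0"
    using key[of a] pos a(1) by auto
  ultimately show ?thesis
    by (metis linorder_neqE_linordered_idom zero_le_mult_iff not_less)
qed

lemma curve_step_in_edge:
  assumes s: "c2_closed_curve s" and i: "i < length s"
  obtains L where "curve_edge s L" "s ! i \<in> L" "s ! ((i + 1) mod length s) \<in> L"
proof -
  define R where "R = {L. curve_run s L \<and> digital_segment L}"
  let ?p = "s ! i" and ?q = "s ! ((i + 1) mod length s)"
  have adj: "c2_adj ?p ?q"
    using s i by (auto simp: c2_closed_curve_def)
  have len: "1 < length s"
  proof (rule ccontr)
    assume "\<not> 1 < length s"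
    with i have "length s = 1" by linarith
    with adj i show False by (simp add: c2_adj_def)
  qed
  have "curve_run s {?p, ?q}"
    unfolding curve_run_def
  proof (intro bexI exI conjI)
    have "{..1::nat} = {0, 1}" by auto
    then show "{?p, ?q} = (\<lambda>j. s ! ((i + j) mod length s)) ` {..1}"
      using i by auto
  qed (use i len in auto)
  moreover have "digital_segment {?p, ?q}"
  proof -
    have sym: "c2_adj ?q ?p"
      using adj by (auto simp: c2_adj_def)
    have "dig_connected c2_adj {?p, ?q}"
      unfolding dig_connected_def
    proof (intro ballI)
      fix a b assume ab: "a \<in> {?p, ?q}" "b \<in> {?p, ?q}"
      let ?r = "\<lambda>a b. a \<in> {?p, ?q} \<and> b \<in> {?p, ?q} \<and> c2_adj a b"
      have "a = b \<or> ?r a b"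
        using ab adj sym by blast
      then show "?r\<^sup>*\<^sup>* a b"
      proof
        assume "a = b"
        then show ?thesis by (simp only: rtranclp.rtrancl_refl)
      qed (rule r_into_rtranclp)
    qed
    moreover have "card {?p, ?q} > 1"
      using adj by (simp add: c2_adj_def)
    moreover have "collinear (to_plane ` {?p, ?q})"
      by (simp add: collinear_2)
    ultimately show ?thesis
      by (simp add: digital_segment_def)
  qed
  ultimately have mem: "{?p, ?q} \<in> R"
    by (simp add: R_def)
  have "R \<subseteq> Pow (set s)"
  proof -
    have "L \<subseteq> set s" if "curve_run s L" for L
    proof -
      obtain i k where "L = (\<lambda>j. s ! ((i + j) mod length s)) ` {..k}"
        using \<open>curve_run s L\<close> unfolding curve_run_def by blast
      moreover have "s ! (n mod length s) \<in> set s" for n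
        using len by (intro nth_mem mod_less_divisor) linarith
      ultimately show ?thesis by blast
    qed
    then show ?thesis by (auto simp: R_def)
  qed
  then have "finite R"
    by (simp add: finite_subset)
  from finite_has_maximal2[OF this mem] obtain L
    where L: "L \<in> R" "{?p, ?q} \<subseteq> L" "\<And>L'. L' \<in> R \<Longrightarrow> L \<subseteq> L' \<Longrightarrow> L = L'"
    by blast
  then have "curve_edge s L"
    by (auto simp: curve_edge_def R_def)
  with L(2) show thesis
    by (intro that) auto
qed

lemma curve_step_one_side:
  assumes s: "c2_closed_curve s" and i: "i < length s" and sub: "set s \<subseteq> Y"
    and fr: "\<And>L. curve_edge s L \<Longrightarrow> plane_hull L \<subseteq> frontier (plane_hull Y)"
    and p: "p = s ! i" and q: "q = s ! ((i + 1) mod length s)"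
  shows "(\<forall>y\<in>Y. 0 \<le> det2 (q - p) (y - p)) \<or> (\<forall>y\<in>Y. det2 (q - p) (y - p) \<le> 0)"
proof -
  obtain L where L: "curve_edge s L" "p \<in> L" "q \<in> L"
    using curve_step_in_edge[OF s i] p q by blast
  have pq: "p \<in> Y" "q \<in> Y"
    using sub i p q by (auto intro!: nth_mem mod_less_divisor)
  have ne: "p \<noteq> q"
    using s i p q by (auto simp: c2_closed_curve_def c2_adj_def)
  have "midpoint (to_plane p) (to_plane q) \<in> plane_hull L"
    unfolding plane_hull_def
    by (meson L(2,3) convex_contains_segment convex_convex_hull hull_inc imageI
        midpoint_in_closed_segment subsetD)
  then have "midpoint (to_plane p) (to_plane q) \<in> frontier (plane_hull Y)"
    using fr[OF L(1)] by blast
  moreover have "to_plane p \<noteq> to_plane q"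
    using ne by (auto simp: to_plane_def prod_eq_iff)
  moreover have mem: "to_plane y \<in> plane_hull Y" if "y \<in> Y" for y
    using that by (simp add: plane_hull_def hull_inc)
  ultimately have
    "(\<forall>y\<in>plane_hull Y. 0 \<le> det2 (to_plane q - to_plane p) (y - to_plane p)) \<or>
     (\<forall>y\<in>plane_hull Y. det2 (to_plane q - to_plane p) (y - to_plane p) \<le> 0)"
    using frontier_segment_one_side[of "plane_hull Y" "to_plane p" "to_plane q"] pq
    by (simp add: plane_hull_def)
  with mem have
    "(\<forall>y\<in>Y. 0 \<le> det2 (to_plane q - to_plane p) (to_plane y - to_plane p)) \<or>
     (\<forall>y\<in>Y. det2 (to_plane q - to_plane p) (to_plane y - to_plane p) \<le> 0)"
    by blast
  then show ?thesis
    by (simp only: det2_to_plane of_int_0_le_iff of_int_le_0_iff)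
qed

section \<open>The octagonal hull\<close>

text \<open>The eight unit directions, that is, the 8-neighbours of the origin.\<close>

definition compass :: "pixel \<Rightarrow> bool" where
  "compass u \<longleftrightarrow> u \<noteq> 0 \<and> \<bar>fst u\<bar> \<le> 1 \<and> \<bar>snd u\<bar> \<le> 1"

text \<open>
  The octagonal hull of \<open>Y\<close>: the pixels that lie, in each of the eight directions orthogonal to a
  compass direction \<open>u\<close>, at most as far as some pixel of \<open>Y\<close>. The functional \<open>det2 u\<close> is, up to sign,
  one of \<open>x\<close>, \<open>y\<close>, \<open>x + y\<close>, \<open>x - y\<close>.
\<close>

definition oct_hull :: "pixel set \<Rightarrow> pixel set" where
  "oct_hull Y = {p. \<forall>u. compass u \<longrightarrow> (\<exists>y\<in>Y. det2 u p \<le> det2 u y)}"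

lemma compass_minus: "compass (- u) \<longleftrightarrow> compass u"
  by (simp add: compass_def)

lemma compass_iff_c2_adj: "compass (q - p) \<longleftrightarrow> c2_adj p q"
  by (auto simp: compass_def c2_adj_def prod_eq_iff)

lemma compass_cases:
  assumes "compass u"
  shows "u \<in> {(1,0), (1,1), (0,1), (-1,1), (-1,0), (-1,-1), (0,-1), (1,-1)}"
proof -
  obtain a b where "u = (a, b)" by fastforce
  moreover have "a \<in> {-1,0,1}" "b \<in> {-1,0,1}" "(a, b) \<noteq> (0, 0)"
    using assms calculation by (auto simp: compass_def zero_prod_def)
  ultimately show ?thesis by auto
qed

lemma compass_parallel:
  assumes "compass u" "compass v" "det2 u v = 0"
  shows "v = u \<or> v = - u"
  using compass_cases[OF assms(1)] compass_cases[OF assms(2)] assms(3)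
  by (auto simp: det2_def)

lemma subset_oct_hull: "Y \<subseteq> oct_hull Y"
  by (auto simp: oct_hull_def)

lemma oct_hullD: "p \<in> oct_hull Y \<Longrightarrow> compass u \<Longrightarrow> \<exists>y\<in>Y. det2 u p \<le> det2 u y"
  unfolding oct_hull_def by blast

lemma finite_oct_hull:
  assumes "finite Y"
  shows "finite (oct_hull Y)"
proof -
  have "oct_hull Y \<subseteq> {Min (fst ` Y)..Max (fst ` Y)} \<times> {Min (snd ` Y)..Max (snd ` Y)}"
  proof
    fix p assume p: "p \<in> oct_hull Y"
    have *: "\<exists>y\<in>Y. det2 u p \<le> det2 u y" if "compass u" for u
      using p that by (rule oct_hullD)
    obtain y1 y2 y3 y4 where y: "y1 \<in> Y" "fst p \<le> fst y1" "y2 \<in> Y" "fst y2 \<le> fst p"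
      "y3 \<in> Y" "snd p \<le> snd y3" "y4 \<in> Y" "snd y4 \<le> snd p"
      using *[of "(0, -1)"] *[of "(0, 1)"] *[of "(1, 0)"] *[of "(-1, 0)"]
      by (auto simp: compass_def det2_def zero_prod_def)
    have "fst y1 \<le> Max (fst ` Y)" "Min (fst ` Y) \<le> fst y2"
      "snd y3 \<le> Max (snd ` Y)" "Min (snd ` Y) \<le> snd y4"
      using y assms by simp_all
    with y show "p \<in> {Min (fst ` Y)..Max (fst ` Y)} \<times> {Min (snd ` Y)..Max (snd ` Y)}"
      by (auto simp: mem_Times_iff)
  qed
  then show ?thesis
    by (rule finite_subset) simp
qed

section \<open>Components of the complement of a curve\<close>

lemma dig_component_reachable:
  assumes p: "p \<in> A" and sym: "\<And>a b. adj a b \<Longrightarrow> adj b a"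
  shows "dig_component adj A {q. (\<lambda>a b. a \<in> A \<and> b \<in> A \<and> adj a b)\<^sup>*\<^sup>* p q}"
    (is "dig_component adj A ?C")
proof -
  let ?R = "\<lambda>B a b. a \<in> B \<and> b \<in> B \<and> adj a b"
  have symR: "(?R B)\<^sup>*\<^sup>* b a" if "(?R B)\<^sup>*\<^sup>* a b" for B a b
    using that
  proof induction
    case base
    show ?case by (rule rtranclp.rtrancl_refl)
  next
    case (step y z)
    then have "?R B z y" using sym by blast
    then show ?case using step.IH by (rule converse_rtranclp_into_rtranclp)
  qed
  have inC: "(?R ?C)\<^sup>*\<^sup>* p q" if "(?R A)\<^sup>*\<^sup>* p q" for q
    using that
  proof induction
    case base
    show ?case by (rule rtranclp.rtrancl_refl)
  next
    case (step y z)
    then have "y \<in> ?C" "z \<in> ?C"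
      by (auto intro: rtranclp.rtrancl_into_rtrancl)
    then have "?R ?C y z" using step by blast
    with step.IH show ?case by (rule rtranclp.rtrancl_into_rtrancl)
  qed
  show ?thesis
    unfolding dig_component_def
  proof (intro conjI allI impI)
    show "?C \<subseteq> A"
    proof
      fix q assume "q \<in> ?C"
      then have "(?R A)\<^sup>*\<^sup>* p q" by simp
      then show "q \<in> A" by cases (use p in auto)
    qed
    show "dig_connected adj ?C"
      unfolding dig_connected_def
    proof (intro ballI)
      fix a b assume "a \<in> ?C" "b \<in> ?C"
      then have "(?R ?C)\<^sup>*\<^sup>* p a" "(?R ?C)\<^sup>*\<^sup>* p b"
        using inC by blast+
      with symR show "(?R ?C)\<^sup>*\<^sup>* a b" by (meson rtranclp_trans)
    qed
    fix C' assume C': "?C \<subseteq> C' \<and> C' \<subseteq> A \<and> dig_connected adj C'"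
    have "p \<in> C'" using C' by auto
    have "C' \<subseteq> ?C"
    proof
      fix q assume "q \<in> C'"
      then have "(?R C')\<^sup>*\<^sup>* p q"
        using C' \<open>p \<in> C'\<close> unfolding dig_connected_def by blast
      moreover have "(?R C') a b \<longrightarrow> (?R A) a b" for a b
        using C' by blast
      ultimately show "q \<in> ?C"
        using rtranclp_mono[of "?R C'" "?R A"] by blast
    qed
    with C' show "C' = ?C" by blast
  qed
qed

lemma dig_component_step:
  assumes C: "dig_component adj A C" and sym: "\<And>a b. adj a b \<Longrightarrow> adj b a"
    and p: "p \<in> C" and q: "q \<in> A" and pq: "adj p q"
  shows "q \<in> C"
proof -
  let ?R = "\<lambda>B a b. a \<in> B \<and> b \<in> B \<and> adj a b"
  have con: "dig_connected adj (insert q C)"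
    unfolding dig_connected_def
  proof (intro ballI)
    have mono: "(?R (insert q C))\<^sup>*\<^sup>* a b" if "(?R C)\<^sup>*\<^sup>* a b" for a b
      using that by (rule rtranclp_mono[THEN predicate2D, rotated]) auto
    have 1: "(?R (insert q C))\<^sup>*\<^sup>* p b" "(?R (insert q C))\<^sup>*\<^sup>* b p" if "b \<in> insert q C" for b
    proof -
      have "?R (insert q C) p q" "?R (insert q C) q p"
        using p pq sym by auto
      moreover have "(?R C)\<^sup>*\<^sup>* p b" "(?R C)\<^sup>*\<^sup>* b p" if "b \<in> C"
        using C p that unfolding dig_component_def dig_connected_def by blast+
      ultimately show "(?R (insert q C))\<^sup>*\<^sup>* p b" "(?R (insert q C))\<^sup>*\<^sup>* b p"
        using that mono by blast+
    qed
    fix a b assume "a \<in> insert q C" "b \<in> insert q C"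
    then show "(?R (insert q C))\<^sup>*\<^sup>* a b"
      using 1 by (meson rtranclp_trans)
  qed
  have "insert q C \<subseteq> A" "C \<subseteq> insert q C"
    using C q by (auto simp: dig_component_def)
  with C con have "insert q C = C"
    unfolding dig_component_def by blast
  then show ?thesis by blast
qed

lemma rtranclp_exit:
  assumes "R\<^sup>*\<^sup>* a b" "a \<in> K" "b \<notin> K"
  obtains x y where "R x y" "x \<in> K" "y \<notin> K"
  using assms by (induction rule: rtranclp_induct) auto

lemma c1_adj_sym: "c1_adj a b \<Longrightarrow> c1_adj b a"
  by (auto simp: c1_adj_def)

lemma closed_curve_neighbours:
  assumes s: "c2_closed_curve s" and len: "3 \<le> length s" and q: "q \<in> set s"
  obtains i j p r where "i < length s" "q = s ! i" "r = s ! ((i + 1) mod length s)"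
    "j < length s" "p = s ! j" "q = s ! ((j + 1) mod length s)" "p \<noteq> r"
proof -
  let ?m = "length s"
  obtain i where i: "i < ?m" "q = s ! i"
    using q by (auto simp: in_set_conv_nth)
  define j where "j = (i + ?m - 1) mod ?m"
  have j: "j < ?m"
    unfolding j_def using len by (intro mod_less_divisor) linarith
  have "(j + 1) mod ?m = (i + ?m - 1 + 1) mod ?m"
    unfolding j_def by (rule mod_add_left_eq)
  also have "i + ?m - 1 + 1 = i + ?m" using len by linarith
  also have "(i + ?m) mod ?m = i" using i by simp
  finally have ji: "(j + 1) mod ?m = i" .
  have jv: "j = (if i = 0 then ?m - 1 else i - 1)"
    using i len by (auto simp: j_def mod_if)
  have iv: "(i + 1) mod ?m = (if i = ?m - 1 then 0 else i + 1)"
    using i by (auto simp: mod_if)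
  have "j \<noteq> (i + 1) mod ?m"
    using i len jv iv by (auto split: if_splits)
  then have "s ! j \<noteq> s ! ((i + 1) mod ?m)"
    using s j i by (simp add: c2_closed_curve_def nth_eq_iff_index_eq)
  then show thesis
    using that[of i "s ! ((i + 1) mod ?m)" j "s ! j"] i j ji by simp
qed

section \<open>A digitally convex disk equals its octagonal hull\<close>

text \<open>
  Let \<open>u\<close> and \<open>u'\<close> be the directions from the curve pixel \<open>q\<close> to its two neighbours on the curve.
  If a side of the octagonal hull contains \<open>q\<close> and \<open>q + v\<close>, then \<open>v\<close> is \<open>u\<close> or \<open>u'\<close>. Otherwise, since \<open>q + v\<close>
  is in the hull, \<open>Y\<close> reaches beyond the line along \<open>u\<close> on the side of \<open>v\<close>, so all of \<open>Y\<close> is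
  on that side, including \<open>q + u'\<close>; hence \<open>u'\<close> is on the \<open>v\<close>-side of \<open>u\<close>. By symmetry, \<open>u\<close> is on
  the \<open>v\<close>-side of \<open>u'\<close>. Both are on the same side of the line along \<open>v\<close>, so \<open>u\<close> and \<open>u'\<close> coincide.
  If \<open>v = - u\<close>, then \<open>q + u\<close> is on the wrong side of the line along \<open>u'\<close>, and likewise for \<open>u'\<close>.
\<close>

lemma extend_along_side:
  assumes u: "compass u" "q + u \<in> Y" and u': "compass u'" "q + u' \<in> Y" and ne: "u \<noteq> u'"
    and side_u: "(\<forall>y\<in>Y. 0 \<le> det2 u (y - q)) \<or> (\<forall>y\<in>Y. det2 u (y - q) \<le> 0)"
    and side_u': "(\<forall>y\<in>Y. 0 \<le> det2 u' (y - q)) \<or> (\<forall>y\<in>Y. det2 u' (y - q) \<le> 0)"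
    and v: "compass v" "q + v \<in> oct_hull Y"
    and side: "(\<forall>y\<in>Y. 0 \<le> det2 v (y - q)) \<or> (\<forall>y\<in>Y. det2 v (y - q) \<le> 0)"
  shows "v = u \<or> v = u'"
proof (rule ccontr)
  assume "\<not> (v = u \<or> v = u')"
  then have nv: "v \<noteq> u" "v \<noteq> u'" by auto
  have bound: "\<exists>y\<in>Y. det2 w v \<le> det2 w (y - q)" if w: "compass w" for w
  proof -
    obtain y where "y \<in> Y" "det2 w (q + v) \<le> det2 w y"
      using oct_hullD[OF v(2) w] by blast
    then show ?thesis by (intro bexI[of _ y]) (simp_all add: det2_add_right det2_diff_right)
  qed
  have determined: "(0 < det2 w v \<longrightarrow> (\<forall>y\<in>Y. 0 \<le> det2 w (y - q)))
      \<and> (det2 w v < 0 \<longrightarrow> (\<forall>y\<in>Y. det2 w (y - q) \<le> 0))"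
    if w: "compass w" and "(\<forall>y\<in>Y. 0 \<le> det2 w (y - q)) \<or> (\<forall>y\<in>Y. det2 w (y - q) \<le> 0)" for w
    using that(2) bound[OF w] bound[of "- w"] w
    by (fastforce simp: compass_minus det2_minus_left)
  have sg: "(0 \<le> det2 v u \<and> 0 \<le> det2 v u') \<or> (det2 v u \<le> 0 \<and> det2 v u' \<le> 0)"
    using side u(2) u'(2) by (metis add_diff_cancel_left')
  have d1: "(0 < det2 u v \<longrightarrow> 0 \<le> det2 u u') \<and> (det2 u v < 0 \<longrightarrow> det2 u u' \<le> 0)"
    using determined[OF u(1) side_u] u'(2) by (metis add_diff_cancel_left')
  have d2: "(0 < det2 u' v \<longrightarrow> 0 \<le> det2 u' u) \<and> (det2 u' v < 0 \<longrightarrow> det2 u' u \<le> 0)"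
    using determined[OF u'(1) side_u'] u(2) by (metis add_diff_cancel_left')
  show False
  proof (cases "det2 u v = 0 \<or> det2 u' v = 0")
    case True
    then have "v = - u \<or> v = - u'"
      using compass_parallel[OF u(1) v(1)] compass_parallel[OF u'(1) v(1)] nv by auto
    then show False
    proof
      assume "v = - u"
      then have e: "det2 u' v = - det2 u' u" by (simp add: det2_def algebra_simps)
      with d2 have "det2 u' v = 0" by linarith
      then show False
        using compass_parallel[OF u'(1) v(1)] nv \<open>v = - u\<close> ne by auto
    next
      assume "v = - u'"
      then have e: "det2 u v = - det2 u u'" by (simp add: det2_def algebra_simps)
      with d1 have "det2 u v = 0" by linarith
      then show False
        using compass_parallel[OF u(1) v(1)] nv \<open>v = - u'\<close> ne by auto
    qed
  next
    case False
    then have "det2 u u' = 0"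
      using sg d1 d2 det2_swap[of v u] det2_swap[of v u'] det2_swap[of u u'] by linarith
    then have "u' = - u"
      using compass_parallel[OF u(1) u'(1)] ne by auto
    then have "det2 u' v = - det2 u v"
      by (simp add: det2_minus_left)
    with False sg det2_swap[of v u] det2_swap[of v u'] show False by linarith
  qed
qed


lemma multiple_of_compass:
  assumes "compass v" "det2 v d = 0"
  obtains k where "d = (k * fst v, k * snd v)"
proof -
  obtain a b where d: "d = (a, b)" by fastforce
  define k where "k = (if fst v \<noteq> 0 then fst v * a else snd v * b)"
  have "d = (k * fst v, k * snd v)"
    using compass_cases[OF assms(1)] assms(2) unfolding d k_def by (auto simp: det2_def)
  then show thesis by (rule that)
qed

lemma oct_hull_between:
  assumes p: "p \<in> oct_hull Y" and q: "p + (k * fst v, k * snd v) \<in> oct_hull Y"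
    and j: "0 \<le> j" "j \<le> k"
  shows "p + (j * fst v, j * snd v) \<in> oct_hull Y"
  unfolding oct_hull_def
proof (intro CollectI allI impI)
  fix u assume u: "compass u"
  have e: "det2 u (p + (i * fst v, i * snd v)) = det2 u p + i * det2 u v" for i
    by (simp add: det2_def algebra_simps)
  obtain y y' where y: "y \<in> Y" "det2 u p \<le> det2 u y" "y' \<in> Y" "det2 u p + k * det2 u v \<le> det2 u y'"
    using oct_hullD[OF p u] oct_hullD[OF q u] unfolding e by blast
  show "\<exists>y\<in>Y. det2 u (p + (j * fst v, j * snd v)) \<le> det2 u y"
  proof (cases "0 \<le> det2 u v")
    case True
    then have "j * det2 u v \<le> k * det2 u v" using j by (intro mult_right_mono)
    then show ?thesis using y by (intro bexI[of _ y']) (auto simp: e)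
  next
    case False
    then have "j * det2 u v \<le> 0" using j by (simp add: mult_nonneg_nonpos)
    then show ?thesis using y by (intro bexI[of _ y]) (auto simp: e)
  qed
qed

text \<open>
  Pixel by pixel, a set \<open>S\<close> with the extension property of the preceding lemma fills each side of the
  octagonal hull that it meets. The hypothesis about \<open>v\<close> says that \<open>q\<close> is on a side of direction \<open>v\<close>; it
  is symmetric in \<open>v\<close> and \<open>- v\<close>, so that the side can be followed either way.
\<close>

lemma whole_side:
  assumes extend: "\<And>q v. q \<in> S \<Longrightarrow> compass v \<Longrightarrow> q + v \<in> oct_hull Y \<Longrightarrow>
      (\<forall>y\<in>Y. 0 \<le> det2 v (y - q)) \<or> (\<forall>y\<in>Y. det2 v (y - q) \<le> 0) \<Longrightarrow> q + v \<in> S"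
    and q: "q \<in> S" "q \<in> oct_hull Y" and v: "compass v"
    and side: "(\<forall>y\<in>Y. 0 \<le> det2 v (y - q)) \<or> (\<forall>y\<in>Y. det2 v (y - q) \<le> 0)"
    and p: "p \<in> oct_hull Y" "det2 v p = det2 v q"
  shows "p \<in> S"
proof -
  have forward: "q + (int n * fst w, int n * snd w) \<in> S"
    if w: "compass w" "(\<forall>y\<in>Y. 0 \<le> det2 w (y - q)) \<or> (\<forall>y\<in>Y. det2 w (y - q) \<le> 0)"
      and "q + (int n * fst w, int n * snd w) \<in> oct_hull Y" for w n
    using that(3)
  proof (induction n)
    case 0
    show ?case using q(1) by (simp add: zero_prod_def[symmetric])
  next
    case (Suc n)
    let ?r = "q + (int n * fst w, int n * snd w)"
    have "?r \<in> oct_hull Y"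
      using q(2) Suc.prems by (rule oct_hull_between) auto
    then have r: "?r \<in> S" by (rule Suc.IH)
    have e: "q + (int (Suc n) * fst w, int (Suc n) * snd w) = ?r + w"
      by (simp add: prod_eq_iff algebra_simps)
    have "det2 w (y - ?r) = det2 w (y - q)" for y
      by (simp add: det2_def algebra_simps)
    with w have "(\<forall>y\<in>Y. 0 \<le> det2 w (y - ?r)) \<or> (\<forall>y\<in>Y. det2 w (y - ?r) \<le> 0)"
      by simp
    from extend[OF r w(1) _ this] show ?case
      using Suc.prems unfolding e by blast
  qed
  have "det2 v (p - q) = 0"
    using p(2) by (simp add: det2_diff_right)
  then obtain k where "p - q = (k * fst v, k * snd v)"
    using multiple_of_compass[OF v] by blast
  then have k: "p = q + (k * fst v, k * snd v)"
    by (metis add.commute diff_add_cancel)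
  show ?thesis
  proof (cases "0 \<le> k")
    case True
    then show ?thesis using forward[OF v side, of "nat k"] p(1) k by simp
  next
    case False
    have "(\<forall>y\<in>Y. 0 \<le> det2 (- v) (y - q)) \<or> (\<forall>y\<in>Y. det2 (- v) (y - q) \<le> 0)"
      using side by (auto simp: det2_minus_left)
    then show ?thesis
      using forward[of "- v" "nat (- k)"] False p(1) k v by (simp add: compass_minus)
  qed
qed

text \<open>
  The finite component adds nothing to the extent of the curve: at a pixel of the component that is
  extremal in some direction, a further 4-step would leave the disk without meeting the curve.
\<close>

lemma support_attained_on_curve:
  assumes F: "F = {} \<or> dig_component c1_adj (- S) F" and Y: "Y = S \<union> F"
    and y: "y \<in> Y" and max: "\<And>z. z \<in> Y \<Longrightarrow> det2 u z \<le> det2 u y" and u: "compass u"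
  shows "y \<in> S"
proof (rule ccontr)
  assume "y \<notin> S"
  with y Y have yF: "y \<in> F" by blast
  with F have F': "dig_component c1_adj (- S) F" by blast
  obtain e where e: "c1_adj y (y + e)" "0 < det2 u e"
  proof -
    have "\<exists>e. c1_adj 0 e \<and> 0 < det2 u e"
    proof (cases "fst u = 0")
      case True
      then show ?thesis using compass_cases[OF u]
        by (intro exI[of _ "(- snd u, 0)"]) (auto simp: c1_adj_def det2_def)
    next
      case False
      then show ?thesis using compass_cases[OF u]
        by (intro exI[of _ "(0, fst u)"]) (auto simp: c1_adj_def det2_def)
    qed
    then obtain e where "c1_adj 0 e" "0 < det2 u e" by blast
    then show thesis by (intro that[of e]) (auto simp: c1_adj_def)
  qed
  have "y + e \<notin> Y"
    using max[of "y + e"] e(2) by (auto simp: det2_add_right)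
  moreover from this have "y + e \<in> - S" using Y by blast
  ultimately show False
    using dig_component_step[OF F' c1_adj_sym yF _ e(1)] Y by blast
qed

lemma support_exists:
  assumes "finite Y" "Y \<noteq> {}"
  obtains y where "y \<in> Y" "\<And>z. z \<in> Y \<Longrightarrow> det2 u z \<le> (det2 u y :: int)"
proof -
  have "finite (det2 u ` Y)" "det2 u ` Y \<noteq> {}" using assms by auto
  from Max_in[OF this] obtain y where "y \<in> Y" "det2 u y = Max (det2 u ` Y)" by auto
  with assms that show thesis by simp
qed

text \<open>
  A pixel of the hull outside \<open>Y\<close> is in the infinite component, so it is joined to the outside of the hull
  by a 4-path off \<open>S\<close>. A 4-step changes each of the eight functionals by at most 1, so
  the last pixel \<open>x\<close> before the path leaves the hull is on a side of the hull, hence on \<open>S\<close>.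
\<close>

proposition oct_hull_subset_of_sides:
  assumes S: "finite S" "S \<noteq> {}" and F: "finite F" "infinite I"
    and comps: "{C. dig_component c1_adj (- S) C} = {F, I} - {{}}"
    and Y: "Y = S \<union> F"
    and extend: "\<And>q v. q \<in> S \<Longrightarrow> compass v \<Longrightarrow> q + v \<in> oct_hull Y \<Longrightarrow>
      (\<forall>y\<in>Y. 0 \<le> det2 v (y - q)) \<or> (\<forall>y\<in>Y. det2 v (y - q) \<le> 0) \<Longrightarrow> q + v \<in> S"
  shows "oct_hull Y \<subseteq> Y"
proof
  fix p assume p: "p \<in> oct_hull Y"
  have finY: "finite Y" "Y \<noteq> {}" using S F Y by auto
  have F': "F = {} \<or> dig_component c1_adj (- S) F" using comps by blast
  show "p \<in> Y"
  proof (rule ccontr)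
    assume "p \<notin> Y"
    then have pS: "p \<in> - S" and pF: "p \<notin> F" using Y by auto
    let ?R = "\<lambda>a b. a \<in> - S \<and> b \<in> - S \<and> c1_adj a b"
    define C where "C = {q. ?R\<^sup>*\<^sup>* p q}"
    have "dig_component c1_adj (- S) C"
      unfolding C_def using dig_component_reachable[OF pS c1_adj_sym] .
    then have "C \<in> {F, I} - {{}}" unfolding comps[symmetric] by (rule CollectI)
    then have "C = F \<or> C = I" by simp
    moreover have "p \<in> C" by (simp add: C_def)
    ultimately have "C = I" using pF by metis
    with F(2) have "\<not> C \<subseteq> oct_hull Y"
      using finite_oct_hull[OF finY(1)] finite_subset by auto
    then obtain q where "q \<in> C" "q \<notin> oct_hull Y" by blast
    then have q: "?R\<^sup>*\<^sup>* p q" "q \<notin> oct_hull Y" by (simp_all add: C_def)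
    obtain x x' where x: "?R x x'" "x \<in> oct_hull Y" "x' \<notin> oct_hull Y"
      by (rule rtranclp_exit[OF q(1) p q(2)])
    from x(3) have "\<exists>u. compass u \<and> (\<forall>y\<in>Y. det2 u y < det2 u x')"
      unfolding oct_hull_def mem_Collect_eq by (meson not_le)
    then obtain u where u: "compass u" "\<And>y. y \<in> Y \<Longrightarrow> det2 u y < det2 u x'"
      by metis
    obtain y where y: "y \<in> Y" "\<And>z. z \<in> Y \<Longrightarrow> det2 u z \<le> det2 u y"
      using support_exists[OF finY, of u] by metis
    have "det2 u x \<le> det2 u y"
      using oct_hullD[OF x(2) u(1)] y(2) by (meson order_trans)
    moreover have "det2 u x' \<le> det2 u x + 1"
    proof -
      have "det2 u (x' - x) \<le> 1"
        using compass_cases[OF u(1)] x(1) by (auto simp: c1_adj_def det2_def)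
      then show ?thesis by (simp add: det2_diff_right)
    qed
    ultimately have xy: "det2 u x = det2 u y"
      using u(2)[OF y(1)] by linarith
    have yS: "y \<in> S"
      using support_attained_on_curve[OF F' Y y u(1)] .
    have "x \<in> S"
    proof (rule whole_side[OF extend yS _ u(1) _ x(2) xy])
      show "y \<in> oct_hull Y" using y(1) subset_oct_hull by blast
      show "(\<forall>z\<in>Y. 0 \<le> det2 u (z - y)) \<or> (\<forall>z\<in>Y. det2 u (z - y) \<le> 0)"
        using y(2) by (auto simp: det2_diff_right)
    qed
    with x(1) show False by blast
  qed
qed

text \<open>
  A nonempty finite component has pixels of the curve to its left and to its right. In particular, a
  curve of two adjacent pixels encloses nothing.
\<close>

lemma finite_component_within:
  assumes F: "dig_component c1_adj (- S) F" "F \<noteq> {}" "finite F"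
  obtains a b where "a \<in> S" "b \<in> S" "2 \<le> fst b - fst a"
proof -
  have *: "\<exists>a\<in>S. \<exists>p\<in>F. fst a = fst p + e \<and> (\<forall>z\<in>F. e * fst z \<le> e * fst p)"
    if e: "\<bar>e\<bar> = 1" for e :: int
  proof -
    obtain p where p: "p \<in> F" "\<And>z. z \<in> F \<Longrightarrow> det2 (0, - e) z \<le> det2 (0, - e) p"
      using support_exists[OF F(3,2)] by blast
    have "p + (e, 0) \<notin> F"
      using p(2)[of "p + (e, 0)"] e by (auto simp: det2_def abs_if split: if_splits)
    then have "p + (e, 0) \<in> S"
      using dig_component_step[OF F(1) c1_adj_sym p(1), of "p + (e, 0)"] e by (auto simp: c1_adj_def)
    then show ?thesis using p by (intro bexI[of _ "p + (e, 0)"] bexI[of _ p]) (auto simp: det2_def)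
  qed
  obtain a p b q where "a \<in> S" "p \<in> F" "fst a = fst p - 1" "\<forall>z\<in>F. fst p \<le> fst z"
    "b \<in> S" "q \<in> F" "fst b = fst q + 1" "\<forall>z\<in>F. fst z \<le> fst q"
    using *[of "-1"] *[of 1] by auto
  then show thesis by (intro that[of a b]) auto
qed

lemma oct_hull_adjacent_pair:
  assumes "c2_adj a b"
  shows "oct_hull {a, b} \<subseteq> {a, b}"
proof
  fix p assume p: "p \<in> oct_hull {a, b}"
  have u: "compass (b - a)" using assms by (simp add: compass_iff_c2_adj)
  have *: "det2 w (p - a) \<le> max 0 (det2 w (b - a))" if "compass w" for w
    using oct_hullD[OF p that] by (auto simp: det2_diff_right)
  obtain x y where xy: "p - a = (x, y)" by fastforce
  have bounds: "\<forall>w \<in> {(1,0), (1,1), (0,1), (-1,1), (-1,0), (-1,-1), (0,-1), (1,-1)}.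
      det2 w (x, y) \<le> max 0 (det2 w (b - a))"
    using * xy by (auto simp: compass_def zero_prod_def)
  have "(x, y) = 0 \<or> (x, y) = b - a"
    using compass_cases[OF u]
    by (elim insertE emptyE; use bounds in \<open>simp add: det2_def zero_prod_def\<close>; presburger)
  then have "p - a = 0 \<or> p - a = b - a" using xy by simp
  then show "p \<in> {a, b}" by auto
qed

theorem digitally_convex_disk_oct_hull:
  assumes "digitally_convex_disk Y"
  shows "finite Y" "Y \<noteq> {}" "oct_hull Y \<subseteq> Y"
proof -
  obtain s where s: "bounding_curve s Y"
    and fr: "\<And>L. curve_edge s L \<Longrightarrow> plane_hull L \<subseteq> frontier (plane_hull Y)"
    using assms by (auto simp: digitally_convex_disk_def)
  obtain F I where cur: "c2_closed_curve s" and FI: "finite F" "infinite I"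
    and comps: "{C. dig_component c1_adj (- set s) C} = {F, I} - {{}}"
    and Y: "Y = set s \<union> F"
    using s unfolding bounding_curve_def by blast
  have ne: "set s \<noteq> {}" using cur by (simp add: c2_closed_curve_def)
  show "finite Y" "Y \<noteq> {}" using Y FI ne by auto
  show "oct_hull Y \<subseteq> Y"
  proof (cases "3 \<le> length s")
    case True
    show ?thesis
    proof (rule oct_hull_subset_of_sides[OF _ ne FI comps Y])
      fix q v
      assume q: "q \<in> set s" and v: "compass v" "q + v \<in> oct_hull Y"
        and side: "(\<forall>y\<in>Y. 0 \<le> det2 v (y - q)) \<or> (\<forall>y\<in>Y. det2 v (y - q) \<le> 0)"
      obtain i j p r where nb: "i < length s" "q = s ! i" "r = s ! ((i + 1) mod length s)"
        "j < length s" "p = s ! j" "q = s ! ((j + 1) mod length s)" "p \<noteq> r"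
        by (rule closed_curve_neighbours[OF cur True q])
      have adj: "c2_adj q r" "c2_adj p q"
        using cur nb by (auto simp: c2_closed_curve_def)
      have rp: "r \<in> set s" "p \<in> set s"
        using nb ne by (auto intro!: nth_mem mod_less_divisor)
      have sub: "set s \<subseteq> Y" using Y by blast
      have "(\<forall>y\<in>Y. 0 \<le> det2 (r - q) (y - q)) \<or> (\<forall>y\<in>Y. det2 (r - q) (y - q) \<le> 0)"
        using curve_step_one_side[OF cur nb(1) sub fr nb(2,3)] by blast
      moreover have "(\<forall>y\<in>Y. 0 \<le> det2 (q - p) (y - p)) \<or> (\<forall>y\<in>Y. det2 (q - p) (y - p) \<le> 0)"
        using curve_step_one_side[OF cur nb(4) sub fr nb(5,6)] by blast
      moreover have "det2 (q - p) (y - p) = - det2 (p - q) (y - q)" for y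
        by (simp add: det2_def algebra_simps)
      ultimately have sides:
        "(\<forall>y\<in>Y. 0 \<le> det2 (r - q) (y - q)) \<or> (\<forall>y\<in>Y. det2 (r - q) (y - q) \<le> 0)"
        "(\<forall>y\<in>Y. 0 \<le> det2 (p - q) (y - q)) \<or> (\<forall>y\<in>Y. det2 (p - q) (y - q) \<le> 0)"
        by (simp, fastforce)
      have c: "compass (r - q)" "compass (p - q)"
        using adj by (auto simp: compass_iff_c2_adj c2_adj_def)
      have m: "q + (r - q) \<in> Y" "q + (p - q) \<in> Y" "r - q \<noteq> p - q"
        using rp sub nb(7) by auto
      have "v = r - q \<or> v = p - q"
        by (rule extend_along_side[OF c(1) m(1) c(2) m(2,3) sides v side])
      then show "q + v \<in> set s" using rp by auto
    qed simp
  next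
    case False
    have "length s \<noteq> 1" "length s \<noteq> 0"
      using cur by (auto simp: c2_closed_curve_def c2_adj_def)
    with False have "length s = 2" by linarith
    then obtain a b where ab: "s = [a, b]"
      by (metis One_nat_def Suc_1 length_0_conv length_Suc_conv)
    have adj: "c2_adj a b"
      using cur ab by (auto simp: c2_closed_curve_def)
    have "F = {}"
    proof (rule ccontr)
      assume "F \<noteq> {}"
      then have "dig_component c1_adj (- {a, b}) F" using comps ab by auto
      from finite_component_within[OF this \<open>F \<noteq> {}\<close> FI(1)]
      obtain a' b' where "a' \<in> {a, b}" "b' \<in> {a, b}" "2 \<le> fst b' - fst a'" .
      with adj show False by (auto simp: c2_adj_def)
    qed
    then show ?thesis using Y ab oct_hull_adjacent_pair[OF adj] by simp
  qed
qed

section \<open>Nonexpansive maps\<close>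

text \<open>Equal or 8-adjacent, that is, at Chebyshev distance at most 1.\<close>

definition near :: "pixel \<Rightarrow> pixel \<Rightarrow> bool" where
  "near p q \<longleftrightarrow> \<bar>fst p - fst q\<bar> \<le> 1 \<and> \<bar>snd p - snd q\<bar> \<le> 1"

text \<open>The 8-continuous self-maps of the plane.\<close>

definition nonexpansive :: "(pixel \<Rightarrow> pixel) \<Rightarrow> bool" where
  "nonexpansive f \<longleftrightarrow> (\<forall>p q. near p q \<longrightarrow> near (f p) (f q))"

lemma near_iff: "near p q \<longleftrightarrow> c2_adj p q \<or> p = q"
  by (auto simp: near_def c2_adj_def)

lemma near_sym: "near p q \<longleftrightarrow> near q p"
  by (auto simp: near_def)

lemma nonexpansiveD: "nonexpansive f \<Longrightarrow> near p q \<Longrightarrow> near (f p) (f q)"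
  unfolding nonexpansive_def by blast

lemma nonexpansive_comp: "nonexpansive f \<Longrightarrow> nonexpansive g \<Longrightarrow> nonexpansive (f \<circ> g)"
  unfolding nonexpansive_def comp_apply by blast

lemma c2_retraction_UNIV_iff:
  "c2_retraction UNIV X r \<longleftrightarrow> nonexpansive r \<and> range r \<subseteq> X \<and> (\<forall>x\<in>X. r x = x)"
  by (auto simp: c2_retraction_def c2_continuous_def nonexpansive_def near_iff)

section \<open>Retractions onto octagons\<close>

text \<open>
  The retraction onto the half-plane \<open>x + y \<le> f\<close> that moves the other pixels in the direction \<open>(-1, -1)\<close>.
  Pixels with an odd excess \<open>x + y - f\<close> do not reach the bounding line along this direction; they make
  one more step in \<open>x\<close>.
\<close>

fun push :: "int \<Rightarrow> pixel \<Rightarrow> pixel" where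
  "push f (x, y) = (x - (max 0 (x + y - f) + 1) div 2, y - max 0 (x + y - f) div 2)"

lemma push_nonexpansive: "nonexpansive (push f)"
proof -
  have "near (push f (x, y)) (push f (x', y'))" if near: "near (x, y) (x', y')" for x y x' y'
  proof -
    define k k' where "k = max 0 (x + y - f)" and "k' = max 0 (x' + y' - f)"
    define m n m' n' where "m = (k + 1) div 2" "n = k div 2" "m' = (k' + 1) div 2" "n' = k' div 2"
    (* half restates the rounding as linear bounds, so that linear arithmetic suffices. *)
    have half: "k \<le> 2 * m" "2 * m \<le> k + 1" "k - 1 \<le> 2 * n" "2 * n \<le> k"
      "k' \<le> 2 * m'" "2 * m' \<le> k' + 1" "k' - 1 \<le> 2 * n'" "2 * n' \<le> k'"
      unfolding m_n_m'_n'_def by presburger+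
    have zero: "k = 0 \<Longrightarrow> m = 0 \<and> n = 0" "k' = 0 \<Longrightarrow> m' = 0 \<and> n' = 0"
      by (simp_all add: m_n_m'_n'_def)
    have n: "- 1 \<le> x - x'" "x - x' \<le> 1" "- 1 \<le> y - y'" "y - y' \<le> 1"
      using near by (simp_all add: near_def abs_le_iff)
    have "(k = 0 \<and> x + y \<le> f) \<or> (0 < k \<and> k = x + y - f)"
      "(k' = 0 \<and> x' + y' \<le> f) \<or> (0 < k' \<and> k' = x' + y' - f)"
      by (auto simp: k_def k'_def max_def)
    then have "- 1 \<le> (x - m) - (x' - m')" "(x - m) - (x' - m') \<le> 1"
      "- 1 \<le> (y - n) - (y' - n')" "(y - n) - (y' - n') \<le> 1"
      using half zero n by (elim disjE conjE; linarith)+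
    then show ?thesis
      by (simp add: near_def m_n_m'_n'_def k_def k'_def abs_le_iff)
  qed
  then show ?thesis by (simp add: nonexpansive_def split_paired_all)
qed

text \<open>Reflections, used to push onto the other three slanted sides.\<close>

definition flip_x :: "pixel \<Rightarrow> pixel" where "flip_x p = (- fst p, snd p)"
definition flip_y :: "pixel \<Rightarrow> pixel" where "flip_y p = (fst p, - snd p)"

text \<open>The projection onto the box \<open>{a..b} \<times> {c..d}\<close>, coordinate by coordinate.\<close>

definition clip :: "int \<Rightarrow> int \<Rightarrow> int \<Rightarrow> int \<Rightarrow> pixel \<Rightarrow> pixel" where
  "clip a b c d p = (max a (min b (fst p)), max c (min d (snd p)))"

lemma flip_nonexpansive: "nonexpansive flip_x" "nonexpansive flip_y"
  by (auto simp: nonexpansive_def near_def flip_x_def flip_y_def)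

lemma clip_nonexpansive: "nonexpansive (clip a b c d)"
  by (auto simp: nonexpansive_def near_def clip_def)

lemma push_id: "fst p + snd p \<le> f \<Longrightarrow> push f p = p"
  by (cases p) simp

lemma push_result:
  assumes "f < fst p + snd p"
  shows "fst (push f p) + snd (push f p) = f" "fst (push f p) \<le> fst p" "snd (push f p) \<le> snd p"
    and "fst (push f p) - snd (push f p) \<le> fst p - snd p"
    and "fst p - snd p - 1 \<le> fst (push f p) - snd (push f p)"
proof -
  obtain x y where p: "p = (x, y)" by fastforce
  have e: "push f p = (x - (x + y - f + 1) div 2, y - (x + y - f) div 2)"
    using assms by (simp add: p)
  have k: "f < x + y" using assms by (simp add: p)
  show "fst (push f p) + snd (push f p) = f" "fst (push f p) \<le> fst p" "snd (push f p) \<le> snd p"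
    "fst (push f p) - snd (push f p) \<le> fst p - snd p"
    "fst p - snd p - 1 \<le> fst (push f p) - snd (push f p)"
    unfolding e using k by (simp_all add: p; presburger)+
qed

text \<open>
  All eight bounds are attained, which makes the pushes compatible with the box (\<open>corners\<close>) and with
  each other (\<open>cuts\<close>): rounding in the push onto \<open>x - y \<le> h\<close> may lower \<open>x + y\<close> by 1, but a pixel of
  the box with \<open>x - y > h\<close> has \<open>x + y > e\<close>; similarly for \<open>x - y \<ge> g\<close> and \<open>x + y < f\<close>.
\<close>

lemma oct_hull_closed_retract:
  assumes Y: "finite Y" "Y \<noteq> {}" "oct_hull Y \<subseteq> Y"
  shows "\<exists>r. c2_retraction UNIV Y r"
proof -
  have ext: "\<exists>y\<in>Y. \<forall>z\<in>Y. \<phi> z \<le> \<phi> y" for \<phi> :: "pixel \<Rightarrow> int"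
  proof -
    from Y have "Max (\<phi> ` Y) \<in> \<phi> ` Y" by (intro Max_in) auto
    then obtain y where "y \<in> Y" "\<phi> y = Max (\<phi> ` Y)" by auto
    then show ?thesis using Y(1) by (intro bexI[of _ y]) simp_all
  qed
  obtain E where E: "E \<in> Y" "\<And>z. z \<in> Y \<Longrightarrow> fst z \<le> fst E"
    using ext[of fst] by blast
  obtain W where W: "W \<in> Y" "\<And>z. z \<in> Y \<Longrightarrow> fst W \<le> fst z"
    using ext[of "\<lambda>z. - fst z"] by force
  obtain N where N: "N \<in> Y" "\<And>z. z \<in> Y \<Longrightarrow> snd z \<le> snd N"
    using ext[of snd] by blast
  obtain S where S: "S \<in> Y" "\<And>z. z \<in> Y \<Longrightarrow> snd S \<le> snd z"
    using ext[of "\<lambda>z. - snd z"] by force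
  obtain NE where NE: "NE \<in> Y" "\<And>z. z \<in> Y \<Longrightarrow> fst z + snd z \<le> fst NE + snd NE"
    using ext[of "\<lambda>z. fst z + snd z"] by force
  obtain SW where SW: "SW \<in> Y" "\<And>z. z \<in> Y \<Longrightarrow> fst SW + snd SW \<le> fst z + snd z"
    using ext[of "\<lambda>z. - (fst z + snd z)"] by force
  obtain SE where SE: "SE \<in> Y" "\<And>z. z \<in> Y \<Longrightarrow> fst z - snd z \<le> fst SE - snd SE"
    using ext[of "\<lambda>z. fst z - snd z"] by force
  obtain NW where NW: "NW \<in> Y" "\<And>z. z \<in> Y \<Longrightarrow> fst NW - snd NW \<le> fst z - snd z"
    using ext[of "\<lambda>z. snd z - fst z"] by force
  define a b c d e f g h where bounds: "a = fst W" "b = fst E" "c = snd S" "d = snd N"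
    "e = fst SW + snd SW" "f = fst NE + snd NE" "g = fst NW - snd NW" "h = fst SE - snd SE"
  have inY: "a \<le> fst z \<and> fst z \<le> b \<and> c \<le> snd z \<and> snd z \<le> d \<and> e \<le> fst z + snd z \<and>
      fst z + snd z \<le> f \<and> g \<le> fst z - snd z \<and> fst z - snd z \<le> h" if "z \<in> Y" for z
    using E(2)[OF that] W(2)[OF that] N(2)[OF that] S(2)[OF that] NE(2)[OF that] SW(2)[OF that]
      SE(2)[OF that] NW(2)[OF that] by (simp add: bounds)
  have outY: "p \<in> Y" if p: "a \<le> fst p" "fst p \<le> b" "c \<le> snd p" "snd p \<le> d"
      "e \<le> fst p + snd p" "fst p + snd p \<le> f" "g \<le> fst p - snd p" "fst p - snd p \<le> h" for p
  proof -
    have "\<exists>y\<in>Y. det2 u p \<le> det2 u y" if u: "compass u" for u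
      using compass_cases[OF u]
    proof (elim insertE emptyE)
      assume "u = (1, 0)" then show ?thesis using p N(1) by (auto simp: det2_def bounds)
    next
      assume "u = (1, 1)" then show ?thesis using p NW(1) by (intro bexI[of _ NW]) (auto simp: det2_def bounds)
    next
      assume "u = (0, 1)" then show ?thesis using p W(1) by (intro bexI[of _ W]) (auto simp: det2_def bounds)
    next
      assume "u = (-1, 1)" then show ?thesis using p SW(1) by (intro bexI[of _ SW]) (auto simp: det2_def bounds)
    next
      assume "u = (-1, 0)" then show ?thesis using p S(1) by (intro bexI[of _ S]) (auto simp: det2_def bounds)
    next
      assume "u = (-1, -1)" then show ?thesis using p SE(1) by (intro bexI[of _ SE]) (auto simp: det2_def bounds)
    next
      assume "u = (0, -1)" then show ?thesis using p E(1) by (intro bexI[of _ E]) (auto simp: det2_def bounds)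
    next
      assume "u = (1, -1)" then show ?thesis using p NE(1) by (intro bexI[of _ NE]) (auto simp: det2_def bounds)
    qed
    then show ?thesis using Y(3) unfolding oct_hull_def by blast
  qed
  note tight = inY[OF E(1)] inY[OF W(1)] inY[OF N(1)] inY[OF S(1)]
  have order: "a \<le> b" "c \<le> d" "e \<le> f" "g \<le> h"
    using tight(1) by linarith+
  have corners: "a + d \<le> f" "b + c \<le> f" "e \<le> b + c" "e \<le> a + d"
      "a - c \<le> h" "b - d \<le> h" "g \<le> b - d" "g \<le> a - c"
    using tight bounds by linarith+
  have cuts: "2 * b \<le> f + h" "2 * d \<le> f - g" "e + g \<le> 2 * a" "e - h \<le> 2 * c"
    using tight bounds by linarith+
  define r1 where "r1 = clip a b c d"
  define r2 where "r2 = push f"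
  define r3 where "r3 = flip_x \<circ> flip_y \<circ> push (- e) \<circ> flip_y \<circ> flip_x"
  define r4 where "r4 = flip_y \<circ> push h \<circ> flip_y"
  define r5 where "r5 = flip_x \<circ> push (- g) \<circ> flip_x"
  define box where "box p \<longleftrightarrow> a \<le> fst p \<and> fst p \<le> b \<and> c \<le> snd p \<and> snd p \<le> d" for p :: pixel
  have s1: "box (r1 p)" for p
    using order by (simp add: box_def r1_def clip_def)
  have s2: "box (r2 p) \<and> fst (r2 p) + snd (r2 p) \<le> f" if "box p" for p
  proof (cases "fst p + snd p \<le> f")
    case True
    with that show ?thesis by (simp add: r2_def push_id)
  next
    case False
    then have "f < fst p + snd p" by simp
    from push_result[OF this] that corners show ?thesis
      unfolding box_def r2_def by linarith
  qed
  have s3: "box (r3 p) \<and> fst (r3 p) + snd (r3 p) \<le> f \<and> e \<le> fst (r3 p) + snd (r3 p)"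
    if p: "box p" "fst p + snd p \<le> f" for p
  proof (cases "e \<le> fst p + snd p")
    case True
    with p show ?thesis by (simp add: r3_def flip_x_def flip_y_def push_id)
  next
    case False
    define q where "q = flip_y (flip_x p)"
    have "- e < fst q + snd q" using False by (simp add: q_def flip_x_def flip_y_def)
    note push_result[OF this]
    moreover have "fst q = - fst p" "snd q = - snd p"
      "fst (r3 p) = - fst (push (- e) q)" "snd (r3 p) = - snd (push (- e) q)"
      by (simp_all add: q_def r3_def flip_x_def flip_y_def)
    ultimately show ?thesis
      using p corners order unfolding box_def by linarith
  qed
  have s4: "box (r4 p) \<and> fst (r4 p) + snd (r4 p) \<le> f \<and> e \<le> fst (r4 p) + snd (r4 p) \<and>
      fst (r4 p) - snd (r4 p) \<le> h"
    if p: "box p" "fst p + snd p \<le> f" "e \<le> fst p + snd p" for p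
  proof (cases "fst p - snd p \<le> h")
    case True
    with p show ?thesis by (simp add: r4_def flip_y_def push_id)
  next
    case False
    define q where "q = flip_y p"
    have "h < fst q + snd q" using False by (simp add: q_def flip_y_def)
    note push_result[OF this]
    moreover have "fst q = fst p" "snd q = - snd p"
      "fst (r4 p) = fst (push h q)" "snd (r4 p) = - snd (push h q)"
      by (simp_all add: q_def r4_def flip_y_def)
    moreover have "e < fst p + snd p" 
      using False p cuts unfolding box_def by linarith
    ultimately show ?thesis
      using p corners order unfolding box_def by linarith
  qed
  have s5: "box (r5 p) \<and> fst (r5 p) + snd (r5 p) \<le> f \<and> e \<le> fst (r5 p) + snd (r5 p) \<and>
      fst (r5 p) - snd (r5 p) \<le> h \<and> g \<le> fst (r5 p) - snd (r5 p)"
    if p: "box p" "fst p + snd p \<le> f" "e \<le> fst p + snd p" "fst p - snd p \<le> h" for p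
  proof (cases "g \<le> fst p - snd p")
    case True
    with p show ?thesis by (simp add: r5_def flip_x_def push_id)
  next
    case False
    define q where "q = flip_x p"
    have "- g < fst q + snd q" using False by (simp add: q_def flip_x_def)
    note push_result[OF this]
    moreover have "fst q = - fst p" "snd q = snd p"
      "fst (r5 p) = - fst (push (- g) q)" "snd (r5 p) = snd (push (- g) q)"
      by (simp_all add: q_def r5_def flip_x_def)
    moreover have "fst p + snd p < f"
      using False p cuts unfolding box_def by linarith
    ultimately show ?thesis
      using p corners order unfolding box_def by linarith
  qed
  define r where "r = r5 \<circ> r4 \<circ> r3 \<circ> r2 \<circ> r1"
  have "nonexpansive r"
    unfolding r_def r1_def r2_def r3_def r4_def r5_def
    by (intro nonexpansive_comp flip_nonexpansive push_nonexpansive clip_nonexpansive)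
  moreover have "r p \<in> Y" for p
  proof -
    note s2[OF s1[of p]]
    then have "box (r3 (r2 (r1 p))) \<and> fst (r3 (r2 (r1 p))) + snd (r3 (r2 (r1 p))) \<le> f \<and>
        e \<le> fst (r3 (r2 (r1 p))) + snd (r3 (r2 (r1 p)))"
      using s3 by blast
    with s4 s5 show ?thesis
      unfolding r_def comp_apply box_def by (intro outY) blast+
  qed
  moreover have "r p = p" if "p \<in> Y" for p
    using inY[OF that]
    by (simp add: r_def r1_def r2_def r3_def r4_def r5_def clip_def flip_x_def flip_y_def push_id)
  ultimately show ?thesis
    by (auto simp: c2_retraction_UNIV_iff)
qed

section \<open>Gluing retractions at a wedge point\<close>

text \<open>
  The open sectors around those axis directions that are not in \<open>D\<close> are flattened vertically or horizontally
  onto their bounding diagonals. The coordinates are treated independently, both in terms of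
  the original pixel, which makes the map visibly nonexpansive.
\<close>

definition squash :: "pixel set \<Rightarrow> pixel \<Rightarrow> pixel" where
  "squash D p = (let x = fst p; y = snd p;
      x1 = (if (1, 0) \<in> D then x else min x \<bar>y\<bar>);
      y1 = (if (0, 1) \<in> D then y else min y \<bar>x\<bar>)
    in (if (-1, 0) \<in> D then x1 else max x1 (- \<bar>y\<bar>),
        if (0, -1) \<in> D then y1 else max y1 (- \<bar>x\<bar>)))"

lemma squash_nonexpansive: "nonexpansive (squash D)"
proof -
  have lipschitz: "\<bar>min a b - min a' b'\<bar> \<le> 1" "\<bar>max a (- b) - max a' (- b')\<bar> \<le> 1"
    if "\<bar>a - a'\<bar> \<le> 1" "\<bar>b - b'\<bar> \<le> 1" for a a' b b' :: int
    using that by linarith+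
  show ?thesis
    unfolding nonexpansive_def
  proof (intro allI impI)
    fix p q assume "near p q"
    then have n: "\<bar>fst p - fst q\<bar> \<le> 1" "\<bar>snd p - snd q\<bar> \<le> 1"
      by (simp_all add: near_def)
    then have a: "\<bar>\<bar>fst p\<bar> - \<bar>fst q\<bar>\<bar> \<le> 1" "\<bar>\<bar>snd p\<bar> - \<bar>snd q\<bar>\<bar> \<le> 1"
      by linarith+
    show "near (squash D p) (squash D q)"
      unfolding near_def squash_def Let_def fst_conv snd_conv
      by (simp add: n a lipschitz)
  qed
qed

text \<open>
  The cone of a compass direction: for an axis direction, the closed sector of opening angle
  90 degrees around it; for a diagonal direction, the ray. Here \<open>fst u * snd u = 0\<close> singles out the
  axis directions.
\<close>

definition in_cone :: "pixel \<Rightarrow> pixel \<Rightarrow> bool" where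
  "in_cone u p \<longleftrightarrow> (if fst u * snd u = 0 then \<bar>det2 u p\<bar> \<le> fst u * fst p + snd u * snd p
     else det2 u p = 0 \<and> 0 \<le> fst u * fst p + snd u * snd p)"

text \<open>Meant for axis directions \<open>u\<close>: the interior of the sector around \<open>u\<close>.\<close>

definition in_open_sector :: "pixel \<Rightarrow> pixel \<Rightarrow> bool" where
  "in_open_sector u p \<longleftrightarrow> \<bar>det2 u p\<bar> < fst u * fst p + snd u * snd p"

abbreviation axes :: "pixel set" where "axes \<equiv> {(1,0), (0,1), (-1,0), (0,-1)}"

lemma squash_avoids:
  assumes "u \<in> axes" "u \<notin> D"
  shows "\<not> in_open_sector u (squash D p)"
proof -
  obtain x y where p: "p = (x, y)" by fastforce
  obtain x' y' where s: "squash D p = (x', y')" by fastforce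
  have x': "x' = x \<or> \<bar>x'\<bar> = \<bar>y\<bar>" "(1, 0) \<notin> D \<Longrightarrow> x' \<le> \<bar>y\<bar>" "(-1, 0) \<notin> D \<Longrightarrow> - x' \<le> \<bar>y\<bar>"
      "\<bar>y\<bar> < \<bar>x\<bar> \<or> x' = x"
    using s by (auto simp: squash_def Let_def p min_def max_def split: if_splits)
  have y': "y' = y \<or> \<bar>y'\<bar> = \<bar>x\<bar>" "(0, 1) \<notin> D \<Longrightarrow> y' \<le> \<bar>x\<bar>" "(0, -1) \<notin> D \<Longrightarrow> - y' \<le> \<bar>x\<bar>"
      "\<bar>x\<bar> < \<bar>y\<bar> \<or> y' = y"
    using s by (auto simp: squash_def Let_def p min_def max_def split: if_splits)
  from assms(1) show ?thesis
  proof (elim insertE emptyE)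
    assume u: "u = (1, 0)"
    with assms(2) x'(2) have "x' \<le> \<bar>y\<bar>" by simp
    with x'(1,4) y'(1,4) have "x' \<le> \<bar>y'\<bar>" by (elim disjE; linarith)
    then show ?thesis by (simp add: u s in_open_sector_def det2_def)
  next
    assume u: "u = (0, 1)"
    with assms(2) y'(2) have "y' \<le> \<bar>x\<bar>" by simp
    with x'(1,4) y'(1,4) have "y' \<le> \<bar>x'\<bar>" by (elim disjE; linarith)
    then show ?thesis by (simp add: u s in_open_sector_def det2_def)
  next
    assume u: "u = (-1, 0)"
    with assms(2) x'(3) have "- x' \<le> \<bar>y\<bar>" by simp
    with x'(1,4) y'(1,4) have "- x' \<le> \<bar>y'\<bar>" by (elim disjE; linarith)
    then show ?thesis by (simp add: u s in_open_sector_def det2_def)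
  next
    assume u: "u = (0, -1)"
    with assms(2) y'(3) have "- y' \<le> \<bar>x\<bar>" by simp
    with x'(1,4) y'(1,4) have "- y' \<le> \<bar>x'\<bar>" by (elim disjE; linarith)
    then show ?thesis by (simp add: u s in_open_sector_def det2_def)
  qed
qed

lemma squash_id:
  assumes "\<And>u. u \<in> axes \<Longrightarrow> in_open_sector u p \<Longrightarrow> u \<in> D"
  shows "squash D p = p"
proof -
  obtain x y where p: "p = (x, y)" by fastforce
  have "(1, 0) \<in> D \<or> x \<le> \<bar>y\<bar>" "(-1, 0) \<in> D \<or> - x \<le> \<bar>y\<bar>"
    "(0, 1) \<in> D \<or> y \<le> \<bar>x\<bar>" "(0, -1) \<in> D \<or> - y \<le> \<bar>x\<bar>"
    using assms[of "(1,0)"] assms[of "(-1,0)"] assms[of "(0,1)"] assms[of "(0,-1)"]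
    by (auto simp: p in_open_sector_def det2_def)
  then show ?thesis by (auto simp: squash_def Let_def p min_def max_def)
qed

lemma neighbour_in_oct_hull:
  assumes "o' \<in> Y" "p \<in> Y" and "\<And>w. compass w \<Longrightarrow> det2 w u \<le> max 0 (det2 w (p - o'))"
  shows "o' + u \<in> oct_hull Y"
  unfolding oct_hull_def
proof (intro CollectI allI impI)
  fix w assume "compass w"
  from assms(3)[OF this] have "det2 w (o' + u) \<le> det2 w o' \<or> det2 w (o' + u) \<le> det2 w p"
    by (auto simp: det2_add_right det2_diff_right)
  with assms(1,2) show "\<exists>y\<in>Y. det2 w (o' + u) \<le> det2 w y" by blast
qed

text \<open>
  The local structure of a closed set \<open>Y\<close> at one of its pixels \<open>o'\<close>: if \<open>Y\<close> meets a sector at \<open>o'\<close>, it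
  contains the neighbour of \<open>o'\<close> on the axis of the sector.
\<close>

lemma axis_neighbour:
  assumes Y: "oct_hull Y \<subseteq> Y" and o: "o' \<in> Y" and p: "p \<in> Y"
    and u: "u \<in> axes" "in_open_sector u (p - o')"
  shows "o' + u \<in> Y"
proof -
  obtain x y where xy: "p - o' = (x, y)" by fastforce
  have "det2 w u \<le> max 0 (det2 w (x, y))" if "compass w" for w
    using u xy compass_cases[OF that]
    by (elim insertE emptyE) (auto simp: in_open_sector_def det2_def)
  then show ?thesis
    using neighbour_in_oct_hull[OF o p, of u] Y xy by auto
qed

lemma open_sector_in_cone: "u \<in> axes \<Longrightarrow> in_open_sector u p \<Longrightarrow> in_cone u p"
proof -
  assume "u \<in> axes" and p: "in_open_sector u p"
  then have "fst u * snd u = 0" by auto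
  with p show ?thesis
    unfolding in_open_sector_def in_cone_def by (simp only: simp_thms if_True less_imp_le)
qed

lemma no_open_sector:
  assumes "\<And>u. u \<in> axes \<Longrightarrow> \<not> in_open_sector u p"
  shows "\<bar>fst p\<bar> = \<bar>snd p\<bar>"
proof -
  have "fst p \<le> \<bar>snd p\<bar>" "- fst p \<le> \<bar>snd p\<bar>" "snd p \<le> \<bar>fst p\<bar>" "- snd p \<le> \<bar>fst p\<bar>"
    using assms[of "(1,0)"] assms[of "(-1,0)"] assms[of "(0,1)"] assms[of "(0,-1)"]
    by (simp_all add: in_open_sector_def det2_def)
  then show ?thesis by linarith
qed

lemma in_some_cone:
  assumes Y: "oct_hull Y \<subseteq> Y" and o: "o' \<in> Y" and p: "p \<in> Y" "p \<noteq> o'"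
  obtains u where "compass u" "o' + u \<in> Y" "in_cone u (p - o')"
proof (cases "\<exists>u\<in>axes. in_open_sector u (p - o')")
  case True
  then obtain u where u: "u \<in> axes" "in_open_sector u (p - o')" by blast
  have "compass u" using u(1) by (auto simp: compass_def zero_prod_def)
  with axis_neighbour[OF Y o p(1) u] open_sector_in_cone[OF u] that show thesis by blast
next
  case False
  obtain x y where xy: "p - o' = (x, y)" by fastforce
  have eq: "\<bar>x\<bar> = \<bar>y\<bar>" using no_open_sector[of "p - o'"] False xy by auto
  have nz: "x \<noteq> 0" "y \<noteq> 0"
    using eq p(2) xy by (auto simp: prod_eq_iff)
  let ?u = "(sgn x, sgn y)"
  have c: "compass ?u" using nz by (auto simp: compass_def zero_prod_def sgn_if)
  have "det2 w ?u \<le> max 0 (det2 w (x, y))" if "compass w" for w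
    using eq nz compass_cases[OF that]
    by (elim insertE emptyE) (auto simp: det2_def sgn_if abs_if split: if_splits)
  then have "o' + ?u \<in> Y"
    using neighbour_in_oct_hull[OF o p(1), of ?u] Y xy by auto
  moreover have "in_cone ?u (p - o')"
    using eq nz xy by (auto simp: in_cone_def det2_def sgn_if abs_if split: if_splits)
  ultimately show thesis using that c by blast
qed

lemma in_cone_sign:
  assumes u: "compass u" and p: "in_cone u p" "p \<noteq> 0"
  shows "fst u \<noteq> 0 \<Longrightarrow> 1 \<le> fst u * fst p" "snd u \<noteq> 0 \<Longrightarrow> 1 \<le> snd u * snd p"
proof -
  obtain x y where xy: "p = (x, y)" by fastforce
  have nz: "x \<noteq> 0 \<or> y \<noteq> 0" using p(2) by (simp add: xy zero_prod_def)
  have "(fst u \<noteq> 0 \<longrightarrow> 1 \<le> fst u * fst p) \<and> (snd u \<noteq> 0 \<longrightarrow> 1 \<le> snd u * snd p)"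
    using compass_cases[OF u] p(1) nz
    by (elim insertE emptyE; simp add: xy in_cone_def det2_def; linarith)
  then show "fst u \<noteq> 0 \<Longrightarrow> 1 \<le> fst u * fst p" "snd u \<noteq> 0 \<Longrightarrow> 1 \<le> snd u * snd p" by auto
qed

text \<open>
  Compass directions that are neither equal nor adjacent have opposite signs in some coordinate. In that
  coordinate, the nonzero pixels of their cones have opposite signs as well, so they differ by at
  least 2.
\<close>

lemma cones_apart:
  assumes u: "compass u" "in_cone u q" "q \<noteq> 0" and v: "compass v" "in_cone v q'" "q' \<noteq> 0"
    and near: "near q q'"
  shows "near u v"
proof -
  have opposite: "\<bar>a - b\<bar> \<le> 1"
    if "\<bar>a\<bar> \<le> 1" "\<bar>b\<bar> \<le> 1" "a \<noteq> 0 \<Longrightarrow> 1 \<le> a * c" "b \<noteq> 0 \<Longrightarrow> 1 \<le> b * d" "\<bar>c - d\<bar> \<le> 1"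
    for a b c d :: int
  proof (rule ccontr)
    assume "\<not> \<bar>a - b\<bar> \<le> 1"
    with that(1,2) have "a = 1 \<and> b = -1 \<or> a = -1 \<and> b = 1" by linarith
    with that(3-5) show False by auto
  qed
  show ?thesis
    using u(1) v(1) near in_cone_sign[OF u] in_cone_sign[OF v] unfolding near_def compass_def
    by (intro conjI opposite[of "fst u" "fst v" "fst q" "fst q'"]
        opposite[of "snd u" "snd v" "snd q" "snd q'"]) auto
qed

lemma in_cone_scale:
  assumes "0 < k"
  shows "in_cone u (k * x, k * y) \<longleftrightarrow> in_cone u (x, y)"
proof -
  have d: "det2 u (k * x, k * y) = k * det2 u (x, y)"
    by (simp add: det2_def algebra_simps)
  have e: "fst u * (k * x) + snd u * (k * y) = k * (fst u * x + snd u * y)"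
    by (simp add: algebra_simps)
  show ?thesis
    using assms by (simp add: in_cone_def d e abs_mult zero_le_mult_iff)
qed

text \<open>
  The pixel \<open>q'\<close> is on a diagonal ray. A nonzero pixel \<open>q\<close> near \<open>q'\<close> that is in neither of the two open
  sectors next to the ray is on the ray as well, so both pixels are in the same cones.
\<close>

lemma same_ray:
  assumes q': "\<bar>fst q'\<bar> = \<bar>snd q'\<bar>" "q' \<noteq> 0" and q: "q \<noteq> 0" "near q q'"
    and sec: "\<And>a. a \<in> axes \<Longrightarrow> in_cone a q' \<Longrightarrow> \<not> in_open_sector a q"
  shows "in_cone u q \<longleftrightarrow> in_cone u q'"
proof -
  obtain x y x' y' where qq: "q = (x, y)" "q' = (x', y')" by fastforce
  have nz: "x \<noteq> 0 \<or> y \<noteq> 0" "x' \<noteq> 0" "y' \<noteq> 0"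
    using q q' by (auto simp: qq zero_prod_def)
  have n: "\<bar>x - x'\<bar> \<le> 1" "\<bar>y - y'\<bar> \<le> 1"
    using q by (simp_all add: near_def qq)
  have s: "\<bar>y'\<bar> \<le> x' \<Longrightarrow> x \<le> \<bar>y\<bar>" "\<bar>y'\<bar> \<le> - x' \<Longrightarrow> - x \<le> \<bar>y\<bar>"
    "\<bar>x'\<bar> \<le> y' \<Longrightarrow> y \<le> \<bar>x\<bar>" "\<bar>x'\<bar> \<le> - y' \<Longrightarrow> - y \<le> \<bar>x\<bar>"
    using sec[of "(1,0)"] sec[of "(-1,0)"] sec[of "(0,1)"] sec[of "(0,-1)"]
    by (simp_all add: in_open_sector_def in_cone_def det2_def qq)
  have eq: "\<bar>x'\<bar> = \<bar>y'\<bar>" using q'(1) by (simp add: qq)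
  have r: "\<bar>x\<bar> = \<bar>y\<bar> \<and> sgn x = sgn x' \<and> sgn y = sgn y'"
  proof -
    consider "0 < x'" "y' = x'" | "0 < x'" "y' = - x'" | "x' < 0" "y' = x'" | "x' < 0" "y' = - x'"
      using eq nz by linarith
    then show ?thesis
    proof cases
      case 1
      then have "x = y \<and> 0 < x" using s(1,3) n nz(1) by linarith
      with 1 show ?thesis by simp
    next
      case 2
      then have "y = - x \<and> 0 < x" using s(1,4) n nz(1) by linarith
      with 2 show ?thesis by simp
    next
      case 3
      then have "x = y \<and> x < 0" using s(2,4) n nz(1) by linarith
      with 3 show ?thesis by simp
    next
      case 4
      then have "y = - x \<and> x < 0" using s(2,3) n nz(1) by linarith
      with 4 show ?thesis by simp
    qed
  qed
  then have "q = (\<bar>x\<bar> * sgn x', \<bar>x\<bar> * sgn y')" "q' = (\<bar>x'\<bar> * sgn x', \<bar>x'\<bar> * sgn y')"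
    using eq abs_mult_sgn[of x] abs_mult_sgn[of y] abs_mult_sgn[of x'] abs_mult_sgn[of y']
    unfolding qq by metis+
  moreover have "0 < \<bar>x\<bar>" "0 < \<bar>x'\<bar>"
    using r nz by auto
  ultimately show ?thesis
    by (simp only: in_cone_scale)
qed

proposition wedge_retract:
  assumes w: "c2_wedge X X1 X2" and h1: "oct_hull X1 \<subseteq> X1" and h2: "oct_hull X2 \<subseteq> X2"
    and r1: "c2_retraction UNIV X1 r1" and r2: "c2_retraction UNIV X2 r2"
  shows "\<exists>r. c2_retraction UNIV X r"
proof -
  obtain o' where X: "X = X1 \<union> X2" and o: "X1 \<inter> X2 = {o'}"
    and sep: "\<And>x x'. x \<in> X \<Longrightarrow> x' \<in> X \<Longrightarrow> c2_adj x x' \<Longrightarrow> {x, x'} \<subseteq> X1 \<or> {x, x'} \<subseteq> X2"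
    using w unfolding c2_wedge_def by blast
  have oX: "o' \<in> X1" "o' \<in> X2" using o by auto
  note R1 = r1[unfolded c2_retraction_UNIV_iff] and R2 = r2[unfolded c2_retraction_UNIV_iff]
  have apart: False if "compass u" "o' + u \<in> X1" "compass v" "o' + v \<in> X2" "near u v" for u v
  proof -
    have "o' + u \<notin> X1 \<inter> X2" "o' + v \<notin> X1 \<inter> X2"
      using that(1,3) unfolding o by (auto simp: compass_def)
    then have no: "o' + u \<notin> X2" "o' + v \<notin> X1"
      using that(2,4) by blast+
    then have "o' + u \<noteq> o' + v"
      using that(2) by metis
    with that(5) have "c2_adj (o' + u) (o' + v)"
      by (auto simp: near_def c2_adj_def)
    then show False using sep[of "o' + u" "o' + v"] no that(2,4) X by blast
  qed
  define D where "D = {u. o' + u \<in> X}"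
  (* K q: the pixel o' + q belongs to a piece of X2. All other pixels, including those on diagonal
     rays that meet neither set, are left to r1. *)
  define K where "K q \<longleftrightarrow> (\<exists>u. compass u \<and> o' + u \<in> X2 \<and> in_cone u q)" for q
  define glue where "glue q = (if K q then r2 (o' + q) else r1 (o' + q))" for q
  define r where "r p = glue (squash D (p - o'))" for p
  have glue_o: "glue 0 = o'"
    using R1 R2 oX by (simp add: glue_def)
  have separated: "q = 0 \<or> q' = 0"
    if near: "near q q'" and K: "K q" "\<not> K q'"
      and avoid: "\<And>a. a \<in> axes \<Longrightarrow> a \<notin> D \<Longrightarrow> \<not> in_open_sector a q \<and> \<not> in_open_sector a q'" for q q'
  proof (rule ccontr)
    assume "\<not> (q = 0 \<or> q' = 0)"
    then have nz: "q \<noteq> 0" "q' \<noteq> 0" by auto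
    obtain u where u: "compass u" "o' + u \<in> X2" "in_cone u q" using K(1) by (auto simp: K_def)
    show False
    proof (cases "\<exists>a. compass a \<and> a \<in> D \<and> in_cone a q'")
      case True
      then obtain a where a: "compass a" "a \<in> D" "in_cone a q'" by blast
      then have "o' + a \<in> X1" using K(2) X unfolding K_def D_def by blast
      moreover have "near a u"
        using cones_apart[OF u(1,3) nz(1) a(1,3) nz(2) near] near_sym by blast
      ultimately show False using apart a(1) u by blast
    next
      case False
      have ax: "compass a" if "a \<in> axes" for a
        using that by (auto simp: compass_def zero_prod_def)
      have "\<bar>fst q'\<bar> = \<bar>snd q'\<bar>"
      proof (rule no_open_sector)
        show "\<not> in_open_sector a q'" if "a \<in> axes" for a
          using avoid[OF that] False ax[OF that] open_sector_in_cone[OF that] by blast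
      qed
      moreover have "\<not> in_open_sector a q" if "a \<in> axes" "in_cone a q'" for a
        using avoid[OF that(1)] False ax[OF that(1)] that(2) by blast
      ultimately have "in_cone u q'"
        using same_ray[OF _ nz(2,1) near] u(3) by blast
      then show False using K(2) u(1,2) unfolding K_def by blast
    qed
  qed
  have near_shift: "near (o' + q) (o' + q')" if "near q q'" for q q'
    using that by (simp add: near_def)
  have glue_step: "near (glue q) (glue q')"
    if near: "near q q'" and avoid: "\<And>a. a \<in> axes \<Longrightarrow> a \<notin> D \<Longrightarrow> \<not> in_open_sector a q \<and> \<not> in_open_sector a q'"
    for q q'
  proof -
    have n1: "near (r1 (o' + q)) (r1 (o' + q'))" and n2: "near (r2 (o' + q)) (r2 (o' + q'))"
      using R1 R2 nonexpansiveD near_shift[OF near] by blast+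
    have at_o: "r1 o' = o'" "r2 o' = o'" using R1 R2 oX by auto
    consider "K q = K q'" | "q = 0" | "q' = 0"
      using separated[OF near _ _ avoid] separated[of q' q] near near_sym avoid by blast
    then show ?thesis
    proof cases
      case 1
      then show ?thesis using n1 n2 by (simp add: glue_def)
    next
      case 2
      then show ?thesis using n1 n2 at_o by (simp add: glue_def)
    next
      case 3
      then show ?thesis using n1 n2 at_o by (simp add: glue_def)
    qed
  qed
  have "nonexpansive r"
    unfolding nonexpansive_def r_def
  proof (intro allI impI glue_step)
    fix p p' assume "near p p'"
    then have "near (p - o') (p' - o')" by (simp add: near_def)
    then show "near (squash D (p - o')) (squash D (p' - o'))"
      by (rule nonexpansiveD[OF squash_nonexpansive])
  qed (use squash_avoids in blast)
  moreover have "r p \<in> X" for p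
  proof -
    have "r1 q \<in> X" "r2 q \<in> X" for q
      using R1 R2 X by blast+
    then show ?thesis by (simp add: r_def glue_def)
  qed
  moreover have "r p = p" if p: "p \<in> X" for p
  proof -
    have "squash D (p - o') = p - o'"
    proof (rule squash_id)
      fix u assume "u \<in> axes" "in_open_sector u (p - o')"
      then show "u \<in> D"
        using axis_neighbour[OF h1 oX(1)] axis_neighbour[OF h2 oX(2)] p X unfolding D_def by blast
    qed
    then have rp: "r p = glue (p - o')" by (simp add: r_def)
    show ?thesis
    proof (cases "p = o'")
      case True
      then show ?thesis using rp glue_o by simp
    next
      case False
      show ?thesis
      proof (cases "p \<in> X2")
        case True
        then have "K (p - o')"
          using in_some_cone[OF h2 oX(2) True False] unfolding K_def by metis
        then show ?thesis using rp R2 True by (simp add: glue_def)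
      next
        case p2: False
        then have p1: "p \<in> X1" using p X by blast
        obtain u where u: "compass u" "o' + u \<in> X1" "in_cone u (p - o')"
          using in_some_cone[OF h1 oX(1) p1 False] .
        have nz: "p - o' \<noteq> 0" using False by simp
        have "\<not> K (p - o')"
        proof
          assume "K (p - o')"
          then obtain v where v: "compass v" "o' + v \<in> X2" "in_cone v (p - o')"
            by (auto simp: K_def)
          have "near u v"
            using cones_apart[OF u(1,3) nz v(1,3) nz] by (simp add: near_def)
          with apart u v show False by blast
        qed
        then show ?thesis using rp R1 p1 by (simp add: glue_def)
      qed
    qed
  qed
  ultimately show ?thesis
    unfolding c2_retraction_UNIV_iff by blast
qed

section \<open>Approximate fixed points on finite retracts\<close>

text \<open>
  A pursuer at \<open>a n\<close> moves one step towards a target at \<open>b n\<close>, which moves at most one step at the same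
  time. The pursuer cannot overtake a target ahead of it without having been within distance 1, and
  a bounded target cannot run away forever.
\<close>

lemma chase_from_left:
  fixes a b :: "nat \<Rightarrow> int"
  assumes step: "\<And>n. a (Suc n) = a n + sgn (b n - a n)" and b: "\<And>n. \<bar>b (Suc n) - b n\<bar> \<le> 1"
    and bound: "\<And>n. b n \<le> M" and start: "2 \<le> b 0 - a 0"
  shows "\<exists>n. \<bar>b n - a n\<bar> \<le> 1"
proof (rule ccontr)
  assume "\<not> ?thesis"
  then have far: "2 \<le> \<bar>b n - a n\<bar>" for n by (metis not_le zless_imp_add1_zle one_add_one)
  have "2 \<le> b n - a n \<and> a n = a 0 + int n" for n
  proof (induction n)
    case 0
    show ?case using start by simp
  next
    case (Suc n)
    then have "a (Suc n) = a n + 1" using step[of n] by (simp add: sgn_if)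
    with Suc b[of n] far[of "Suc n"] show ?case by linarith
  qed
  from this[of "nat (M - a 0)"] bound[of "nat (M - a 0)"] show False by linarith
qed

text \<open>Once within distance 1, the pursuer stays there, so both coordinates can be treated separately.\<close>

lemma chase_catches_up:
  fixes a b :: "nat \<Rightarrow> int"
  assumes step: "\<And>n. a (Suc n) = a n + sgn (b n - a n)" and b: "\<And>n. \<bar>b (Suc n) - b n\<bar> \<le> 1"
    and bound: "\<And>n. \<bar>b n\<bar> \<le> M"
  obtains N where "\<And>n. N \<le> n \<Longrightarrow> \<bar>b n - a n\<bar> \<le> 1"
proof -
  have bM: "b n \<le> M" "- b n \<le> M" for n
    using bound[of n] by linarith+
  have "\<exists>n. \<bar>b n - a n\<bar> \<le> 1"
  proof -
    consider "2 \<le> b 0 - a 0" | "2 \<le> - b 0 - - a 0" | "\<bar>b 0 - a 0\<bar> \<le> 1" by linarith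
    then show ?thesis
    proof cases
      case 1
      show ?thesis by (rule chase_from_left[OF step b bM(1) 1])
    next
      case 2
      have step': "- a (Suc n) = - a n + sgn (- b n - - a n)" for n
        using step[of n] by (simp add: sgn_if)
      have b': "\<bar>- b (Suc n) - - b n\<bar> \<le> 1" for n using b[of n] by simp
      obtain n where "\<bar>- b n - - a n\<bar> \<le> 1"
        using chase_from_left[of "\<lambda>n. - a n" "\<lambda>n. - b n", OF step' b' bM(2) 2] by blast
      then show ?thesis by (intro exI[of _ n]) simp
    qed blast
  qed
  then obtain N where N: "\<bar>b N - a N\<bar> \<le> 1" by blast
  have "\<bar>b n - a n\<bar> \<le> 1" if "N \<le> n" for n
    using that
  proof (induction n rule: dec_induct)
    case base
    show ?case by (rule N)
  next
    case (step n)
    then show ?case using assms(1)[of n] b[of n] by (auto simp: sgn_if)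
  qed
  then show thesis by (rule that)
qed

lemma finite_image_approximate_fixed_point:
  assumes f: "nonexpansive f" and fin: "finite (range f)"
  obtains p where "near (f p) p"
proof -
  define g where "g p = (fst p + sgn (fst (f p) - fst p), snd p + sgn (snd (f p) - snd p))" for p
  define c where "c n = (g ^^ n) (0, 0)" for n
  have c_Suc: "c (Suc n) = g (c n)" for n by (simp add: c_def)
  have "near (c n) (c (Suc n))" for n
    unfolding c_Suc by (simp add: near_def g_def sgn_if)
  then have nf: "near (f (c n)) (f (c (Suc n)))" for n
    by (rule nonexpansiveD[OF f])
  have "finite ((\<lambda>p. \<bar>fst p\<bar>) ` range f \<union> (\<lambda>p. \<bar>snd p\<bar>) ` range f)" (is "finite ?A")
    using fin by simp
  then have bd: "\<bar>fst (f p)\<bar> \<le> Max ?A" "\<bar>snd (f p)\<bar> \<le> Max ?A" for p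
    by (auto intro!: Max_ge)
  obtain M where M: "\<And>n. M \<le> n \<Longrightarrow> \<bar>fst (f (c n)) - fst (c n)\<bar> \<le> 1"
  proof (rule chase_catches_up[of "\<lambda>n. fst (c n)" "\<lambda>n. fst (f (c n))"])
    show "\<bar>fst (f (c n))\<bar> \<le> Max ?A" for n
      by (rule bd(1))
    show "\<bar>fst (f (c (Suc n))) - fst (f (c n))\<bar> \<le> 1" for n
      using nf[of n] by (simp add: near_def abs_minus_commute)
  qed (use that in \<open>auto simp: c_Suc g_def\<close>)
  obtain N where N: "\<And>n. N \<le> n \<Longrightarrow> \<bar>snd (f (c n)) - snd (c n)\<bar> \<le> 1"
  proof (rule chase_catches_up[of "\<lambda>n. snd (c n)" "\<lambda>n. snd (f (c n))"])
    show "\<bar>snd (f (c n))\<bar> \<le> Max ?A" for n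
      by (rule bd(2))
    show "\<bar>snd (f (c (Suc n))) - snd (f (c n))\<bar> \<le> 1" for n
      using nf[of n] by (simp add: near_def abs_minus_commute)
  qed (use that in \<open>auto simp: c_Suc g_def\<close>)
  have "near (f (c (max M N))) (c (max M N))"
    using M[of "max M N"] N[of "max M N"] by (simp add: near_def)
  then show thesis by (rule that)
qed

proposition finite_retract_AFPP:
  assumes r: "c2_retraction UNIV X r" and X: "finite X"
  shows "c2_AFPP X"
  unfolding c2_AFPP_def
proof (intro allI impI)
  fix f assume f: "c2_continuous X X f"
  have r': "nonexpansive r" "\<And>p. r p \<in> X" "\<And>x. x \<in> X \<Longrightarrow> r x = x"
    using r by (auto simp: c2_retraction_UNIV_iff)
  have "nonexpansive (f \<circ> r)"
    using f r'(1,2) by (simp add: nonexpansive_def c2_continuous_def near_iff) metis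
  moreover have fX: "f (r p) \<in> X" for p
    using f r'(2)[of p] by (auto simp: c2_continuous_def)
  then have "finite (range (f \<circ> r))"
    by (intro finite_subset[OF _ X]) auto
  ultimately obtain p where "near (f (r p)) p"
    using finite_image_approximate_fixed_point by (metis comp_apply)
  then have "near (r (f (r p))) (r p)"
    by (rule nonexpansiveD[OF r'(1)])
  then have "near (f (r p)) (r p)"
    using r'(3)[OF fX] by simp
  then show "\<exists>x\<in>X. c2_adj (f x) x \<or> f x = x"
    using r'(2)[of p] by (auto simp: near_iff)
qed

section \<open>The wedge of two digitally convex disks\<close>

theorem theorem5p3:
  fixes X X1 X2 :: "pixel set"
  assumes "digitally_convex_disk X1" and "digitally_convex_disk X2"
    and "c2_wedge X X1 X2"
  shows "(\<exists>r. c2_retraction UNIV X r) \<and> c2_AFPP X"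
proof -
  note disk1 = digitally_convex_disk_oct_hull[OF assms(1)]
  note disk2 = digitally_convex_disk_oct_hull[OF assms(2)]
  obtain r1 r2 where "c2_retraction UNIV X1 r1" "c2_retraction UNIV X2 r2"
    using oct_hull_closed_retract[OF disk1] oct_hull_closed_retract[OF disk2] by blast
  then obtain r where r: "c2_retraction UNIV X r"
    using wedge_retract[OF assms(3) disk1(3) disk2(3)] by blast
  have "finite X"
    using assms(3) disk1(1) disk2(1) by (simp add: c2_wedge_def)
  with r finite_retract_AFPP show ?thesis by blast
qed

end
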